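(* Let $f \in L^2([0,1))$ and $\gamma>0$ be such that $H_\gamma^\infty(\cdot,f)$ has a unique minimizer $f_\gamma$ over $L^2([0,1))$. Then for any (possibly random) sequence $(\gamma_n)_{n\in\mathbb{N}}\subset(0,\infty)$ with $\gamma_n\to\gamma$ $\mathbb{P}$-a.s., and any estimators $\hat f_n\in\iota^n(\operatorname{argmin} H_{\gamma_n}(\cdot,Y_n))$, we have $$\hat f_n \xrightarrow[n\to\infty]{} f_\gamma \quad\text{in } L^2([0,1)),\qquad \mathbb{P}\text{-a.s.}$$
   Context: Regression model: for $n\in\mathbb{N}$ and $1\le i\le n$, $Y_{i,n}=\bar f_{i,n}+\xi_{i,n}$, where $\bar f_{i,n}=n\int_{(i-1)/n}^{i/n}f(u)\,du$ and $(\xi_{i,n})_{1\le i\le n,\,n\in\mathbb{N}}$ is a triangular array of zero-mean real random variables on a probability space with measure $\mathbb{P}$. Write $Y_n=(Y_{1,n},\dots,Y_{n,n})$. Standing assumption on the noise (Condition (A)): for each $n$ the variables $(\xi_{i,n})_{1\le i\le n}$ are independent, and there is a (deterministic) sequence $(\beta_n)_{n\in\mathbb{N}}$ with $\beta_n/n\to0$ such that $\mathbb{P}$-a.s., for all but finitely many $n$, $\max_{1\le i\le j\le n}\frac{(\xi_{i,n}+\cdots+\xi_{j,n})^2}{j-i+1}\le\beta_n$. For $u\in\mathbb{R}^n$ let $J(u)=\{i:1\le i\le n-1,\ u_i\ne u_{i+1}\}$ and $H_\gamma(u,Y_n)=\gamma\,\#J(u)+\frac1n\sum_{i=1}^n(u_i-Y_{i,n})^2$.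 $\operatorname{argmin}F$ denotes the whole set of minimizers of $F$. The map $\iota^n:\mathbb{R}^n\to L^2([0,1))$ is $\iota^n(u)=\sum_{i=1}^n u_i\mathbf{1}_{[(i-1)/n,i/n)}$. $S([0,1))=\operatorname{span}\{\mathbf 1_{[s,t)}:0\le s<t\le1\}$ is the space of step functions, viewed as a subspace of $L^2([0,1))$; for $g\in S([0,1))$, $\mathcal J(g)=\{t\in(0,1):g(t-)\ne g(t+)\}$ is its set of jumps. $\|\cdot\|$ is the norm of $L^2([0,1))$. For $\gamma>0$ and $g,f\in L^2([0,1))$, $H_\gamma^\infty(g,f)=\gamma\,\#\mathcal J(g)+\|f-g\|^2$ if $g\in S([0,1))$, and $H_\gamma^\infty(g,f)=\infty$ otherwise. *)

theory Defs
  imports "HOL-Probability.Probability"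
begin

(* L^2([0,1)) is represented by its square-integrable functions; its elements are the
   classes of these under a.e. equality on [0,1).  Values outside [0,1) are irrelevant. *)

abbreviation unit_ivl :: "real measure" where
  "unit_ivl \<equiv> lebesgue_on {0..<1}"

definition L2 :: "(real \<Rightarrow> real) set" where
  "L2 = {g \<in> borel_measurable unit_ivl. integrable unit_ivl (\<lambda>x. (g x)\<^sup>2)}"

definition L2_norm :: "(real \<Rightarrow> real) \<Rightarrow> real" where
  "L2_norm g = sqrt (LINT x|unit_ivl. (g x)\<^sup>2)"

definition L2_eq :: "(real \<Rightarrow> real) \<Rightarrow> (real \<Rightarrow> real) \<Rightarrow> bool" where
  "L2_eq g h \<longleftrightarrow> (AE x in unit_ivl. g x = h x)"

(* The linear span of the indicators of [s,t), 0 \<le> s < t \<le> 1, as a set of functions. *)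
definition step_functions :: "(real \<Rightarrow> real) set" where
  "step_functions = {g. \<exists>(m::nat) c s t. (\<forall>k<m. 0 \<le> s k \<and> s k < t k \<and> t k \<le> 1) \<and>
     g = (\<lambda>x. \<Sum>k<m. c k * indicator {s k..<t k} x)}"

definition jumps :: "(real \<Rightarrow> real) \<Rightarrow> real set" where
  "jumps g = {t \<in> {0<..<1}. Lim (at_left t) g \<noteq> Lim (at_right t) g}"

(* The class of g is a step function iff g is a.e. equal to some member of step_functions.
   That member is then unique (step_rep_unique below), and it determines the jump set of
   the class. *)
definition is_step_class :: "(real \<Rightarrow> real) \<Rightarrow> bool" where
  "is_step_class g \<longleftrightarrow> (\<exists>s\<in>step_functions. L2_eq g s)"

definition step_rep :: "(real \<Rightarrow> real) \<Rightarrow> real \<Rightarrow> real" where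
  "step_rep g = (THE s. s \<in> step_functions \<and> L2_eq g s)"

definition H_inf :: "real \<Rightarrow> (real \<Rightarrow> real) \<Rightarrow> (real \<Rightarrow> real) \<Rightarrow> ereal" where
  "H_inf \<gamma> g f =
     (if is_step_class g
      then ereal (\<gamma> * real (card (jumps (step_rep g))) + (L2_norm (\<lambda>x. f x - g x))\<^sup>2)
      else \<infinity>)"

(* Minimizers over L^2([0,1)), unique as an element of that space, i.e. up to L2_eq. *)
definition unique_minimizer :: "real \<Rightarrow> (real \<Rightarrow> real) \<Rightarrow> (real \<Rightarrow> real) \<Rightarrow> bool" where
  "unique_minimizer \<gamma> f g \<longleftrightarrow>
     is_arg_min (\<lambda>h. H_inf \<gamma> h f) (\<lambda>h. h \<in> L2) g \<and>
     (\<forall>h. is_arg_min (\<lambda>h. H_inf \<gamma> h f) (\<lambda>h. h \<in> L2) h \<longrightarrow> L2_eq h g)"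

(* R^n is the set of functions on {1..n} (extensional outside), since n varies. *)

definition H_fin :: "nat \<Rightarrow> real \<Rightarrow> (nat \<Rightarrow> real) \<Rightarrow> (nat \<Rightarrow> real) \<Rightarrow> real" where
  "H_fin n \<gamma> u y = \<gamma> * real (card {i. 1 \<le> i \<and> i \<le> n - 1 \<and> u i \<noteq> u (i + 1)})
     + 1 / real n * (\<Sum>i=1..n. (u i - y i)\<^sup>2)"

definition argmin_H_fin :: "nat \<Rightarrow> real \<Rightarrow> (nat \<Rightarrow> real) \<Rightarrow> (nat \<Rightarrow> real) set" where
  "argmin_H_fin n \<gamma> y =
     {u. is_arg_min (\<lambda>u. H_fin n \<gamma> u y) (\<lambda>u. u \<in> {1..n} \<rightarrow>\<^sub>E UNIV) u}"

definition step_embed :: "nat \<Rightarrow> (nat \<Rightarrow> real) \<Rightarrow> real \<Rightarrow> real" where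
  "step_embed n u = (\<lambda>x. \<Sum>i=1..n. u i * indicator {(real i - 1) / real n..<real i / real n} x)"

definition local_mean :: "(real \<Rightarrow> real) \<Rightarrow> nat \<Rightarrow> nat \<Rightarrow> real" where
  "local_mean f i n = real n * (LINT u:{(real i - 1) / real n..<real i / real n}|lebesgue. f u)"

definition observation :: "(real \<Rightarrow> real) \<Rightarrow> (nat \<Rightarrow> nat \<Rightarrow> 'a \<Rightarrow> real) \<Rightarrow> nat \<Rightarrow> nat \<Rightarrow> 'a \<Rightarrow> real" where
  "observation f \<xi> i n \<omega> = local_mean f i n + \<xi> i n \<omega>"

definition centered_array :: "'a measure \<Rightarrow> (nat \<Rightarrow> nat \<Rightarrow> 'a \<Rightarrow> real) \<Rightarrow> bool" where
  "centered_array M \<xi> \<longleftrightarrow>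
     (\<forall>n\<ge>1. \<forall>i\<in>{1..n}. \<xi> i n \<in> borel_measurable M \<and> integrable M (\<xi> i n) \<and>
        (LINT \<omega>|M. \<xi> i n \<omega>) = 0)"

definition condition_A :: "'a measure \<Rightarrow> (nat \<Rightarrow> nat \<Rightarrow> 'a \<Rightarrow> real) \<Rightarrow> bool" where
  "condition_A M \<xi> \<longleftrightarrow>
     (\<forall>n\<ge>1. prob_space.indep_vars M (\<lambda>_. borel) (\<lambda>i. \<xi> i n) {1..n}) \<and>
     (\<exists>\<beta>::nat \<Rightarrow> real. (\<lambda>n. \<beta> n / real n) \<longlonglongrightarrow> 0 \<and>
        (AE \<omega> in M. \<forall>\<^sub>F n in sequentially.
           (MAX (i, j) \<in> {(i, j). 1 \<le> i \<and> i \<le> j \<and> j \<le> n}.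
              (\<Sum>k=i..j. \<xi> k n \<omega>)\<^sup>2 / real (j - i + 1)) \<le> \<beta> n))"

lemma step_function_right:
  assumes "g \<in> step_functions"
  shows "\<forall>\<^sub>F y in at_right x. g y = g x"
proof -
  obtain m :: nat and c s t where g: "g = (\<lambda>x. \<Sum>k<m. c k * indicator {s k..<t k} x)"
    using assms by (auto simp: step_functions_def)
  have "\<forall>\<^sub>F y in at_right x. indicator {a..<b} y = (indicator {a..<b} x :: real)" for a b :: real
  proof -
    have "\<forall>\<^sub>F y in at_right x. y > x" by (simp add: eventually_at_right_less)
    moreover have "\<forall>\<^sub>F y in at_right x. x < a \<longrightarrow> y < a"
      by (cases "x < a") (auto intro: eventually_at_right_real eventually_mono[OF eventually_at_right_real])
    moreover have "\<forall>\<^sub>F y in at_right x. x < b \<longrightarrow> y < b"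
      by (cases "x < b") (auto intro: eventually_at_right_real eventually_mono[OF eventually_at_right_real])
    ultimately show ?thesis
      by eventually_elim (auto simp: indicator_def)
  qed
  then have "\<forall>\<^sub>F y in at_right x. \<forall>k\<in>{..<m}. indicator {s k..<t k} y = (indicator {s k..<t k} x :: real)"
    by (intro eventually_ball_finite) auto
  then show ?thesis
    unfolding g by eventually_elim (auto intro!: sum.cong)
qed

lemma step_function_outside:
  assumes "g \<in> step_functions" "x \<notin> {0..<1}"
  shows "g x = 0"
  using assms by (force simp: step_functions_def indicator_def intro!: sum.neutral)

lemma step_rep_unique:
  assumes "s \<in> step_functions" "s' \<in> step_functions" "L2_eq g s" "L2_eq g s'"
  shows "s = s'"
proof (rule ccontr)
  assume "s \<noteq> s'"
  then obtain x where x: "s x \<noteq> s' x" by blast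
  then have "x \<in> {0..<1}"
    using step_function_outside[OF assms(1), of x] step_function_outside[OF assms(2), of x] by metis
  then have x01: "0 \<le> x" "x < 1" by auto
  have "\<forall>\<^sub>F y in at_right x. s y \<noteq> s' y"
    using step_function_right[OF assms(1), of x] step_function_right[OF assms(2), of x]
    by eventually_elim (use x in auto)
  moreover have "\<forall>\<^sub>F y in at_right x. y \<in> {x<..<1}"
    by (rule eventually_at_right_real) (use x01 in auto)
  ultimately have "\<forall>\<^sub>F y in at_right x. s y \<noteq> s' y \<and> y < 1"
    by eventually_elim auto
  then obtain b where b: "b > x" "\<And>y. y > x \<Longrightarrow> y < b \<Longrightarrow> s y \<noteq> s' y \<and> y < 1"
    unfolding eventually_at_right_field by blast
  have "AE y in unit_ivl. s y = s' y"
    using assms(3,4) unfolding L2_eq_def by eventually_elim auto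
  then have "AE y in lebesgue. y \<in> {0..<1} \<longrightarrow> s y = s' y"
    by (simp add: AE_restrict_space_iff)
  then have "AE y in lebesgue. y \<notin> {x<..<b}"
    by eventually_elim (use b x01 in force)
  then have "emeasure lebesgue {x<..<b} = 0"
    by (subst (asm) AE_iff_measurable[where N = "{x<..<b}"]) auto
  then show False using b(1) by simp
qed

lemma step_rep_eq:
  assumes "s \<in> step_functions" "L2_eq g s"
  shows "step_rep g = s"
  unfolding step_rep_def using assms by (blast intro: step_rep_unique the_equality)

end

theory Submission
  imports Defs
begin

text \<open>
  Fix an outcome outside a null set. Expanding the square gives
  \<open>H_fin n \<gamma> u Y = \<gamma> #J(u) + \<parallel>f - \<iota> u\<parallel>\<^sup>2 - (2/n) \<Sum> u\<^sub>i \<xi>\<^sub>i\<close> up to a term not depending on \<open>u\<close>,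
  because \<open>\<iota> u\<close> only sees the local means of \<open>f\<close>; no convergence of the discretised signal is needed.
  Summing the noise over the constancy blocks of \<open>u\<close>, Condition (A) and Cauchy-Schwarz bound the last
  term by \<open>sqrt (\<beta>\<^sub>n/n) (#J(u) + 1 + \<parallel>\<iota> u\<parallel>\<^sup>2)\<close>. Comparing the estimator with \<open>0\<close> bounds its
  number of jumps and its norm, and comparing it with samples of \<open>f\<^sub>\<gamma>\<close> on the grid shows that it is a
  minimizing sequence of \<open>H\<^sub>\<gamma>\<^sup>\<infinity>\<close>. Step functions with boundedly many jumps and bounded norm have
  subsequences converging almost everywhere to such step functions. By Fatou's lemma the limit is a
  minimizer, hence \<open>f\<^sub>\<gamma>\<close>, and the norms converge, so the convergence is strong.
\<close>

section \<open>Square-integrable functions on the unit interval\<close>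

lemma unit_ivl_finite_measure: "finite_measure unit_ivl"
  by (rule finite_measureI) (simp add: emeasure_restrict_space)

lemma borel_unit_ivl: "g \<in> borel_measurable borel \<Longrightarrow> g \<in> borel_measurable unit_ivl"
  for g :: "real \<Rightarrow> real"
  by (intro measurable_restrict_space1 measurable_completion) simp

lemma integrable_unit_ivl_bounded:
  fixes g :: "real \<Rightarrow> real"
  assumes "g \<in> borel_measurable unit_ivl" "\<And>x. \<bar>g x\<bar> \<le> B"
  shows "integrable unit_ivl g"
  by (rule finite_measure.integrable_const_bound[OF unit_ivl_finite_measure, of _ B]) (use assms in auto)

lemma L2_bounded:
  assumes "g \<in> borel_measurable unit_ivl" "\<And>x. \<bar>g x\<bar> \<le> B"
  shows "g \<in> L2"
proof -
  have "\<bar>(g x)\<^sup>2\<bar> \<le> B\<^sup>2" for x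
    using power_mono[OF assms(2)[of x], of 2] by simp
  then show ?thesis
    unfolding L2_def using assms(1) by (auto intro!: integrable_unit_ivl_bounded[where B="B\<^sup>2"])
qed

lemma L2_mult_integrable:
  assumes "g \<in> L2" "h \<in> L2"
  shows "integrable unit_ivl (\<lambda>x. g x * h x)"
proof (rule Bochner_Integration.integrable_bound)
  show "integrable unit_ivl (\<lambda>x. (g x)\<^sup>2 + (h x)\<^sup>2)"
    using assms by (auto simp: L2_def)
  show "(\<lambda>x. g x * h x) \<in> borel_measurable unit_ivl"
    using assms by (auto simp: L2_def)
  have "\<bar>a * b\<bar> \<le> a\<^sup>2 + b\<^sup>2" for a b :: real
    using sum_squares_bound[of "\<bar>a\<bar>" "\<bar>b\<bar>"] mult_nonneg_nonneg[of "\<bar>a\<bar>" "\<bar>b\<bar>"]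
    unfolding abs_mult by (simp only: power2_abs) linarith
  then show "AE x in unit_ivl. norm (g x * h x) \<le> norm ((g x)\<^sup>2 + (h x)\<^sup>2)"
    by (auto simp: abs_mult)
qed

lemma L2_diff:
  assumes "g \<in> L2" "h \<in> L2"
  shows "(\<lambda>x. g x - h x) \<in> L2"
proof -
  have "integrable unit_ivl (\<lambda>x. (g x)\<^sup>2 - 2 * (g x * h x) + (h x)\<^sup>2)"
    using assms L2_mult_integrable[OF assms] by (auto simp: L2_def)
  then show ?thesis
    using assms by (auto simp: L2_def power2_diff algebra_simps)
qed

lemma L2_norm_power2: "(L2_norm g)\<^sup>2 = (LINT x|unit_ivl. (g x)\<^sup>2)"
  unfolding L2_norm_def by simp

lemma L2_norm_sq_diff:
  assumes "g \<in> L2" "h \<in> L2"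
  shows "(L2_norm (\<lambda>x. g x - h x))\<^sup>2 =
    (L2_norm g)\<^sup>2 - 2 * (LINT x|unit_ivl. g x * h x) + (L2_norm h)\<^sup>2"
proof -
  have I: "integrable unit_ivl (\<lambda>x. (g x)\<^sup>2)" "integrable unit_ivl (\<lambda>x. (h x)\<^sup>2)"
    using assms by (auto simp: L2_def)
  have "(L2_norm (\<lambda>x. g x - h x))\<^sup>2 = (LINT x|unit_ivl. (g x)\<^sup>2 - 2 * (g x * h x) + (h x)\<^sup>2)"
    unfolding L2_norm_power2 by (intro Bochner_Integration.integral_cong) (auto simp: power2_diff)
  then show ?thesis
    using I L2_mult_integrable[OF assms] by (simp add: L2_norm_power2)
qed

text \<open>Pointwise this is \<open>(a - 2 * b)^2 \<ge> 0\<close>. It turns control of the distance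
  to the signal into control of the norm.\<close>

lemma L2_norm_sq_triangle:
  assumes "g \<in> L2" "h \<in> L2"
  shows "(L2_norm g)\<^sup>2 \<le> 2 * (L2_norm (\<lambda>x. h x - g x))\<^sup>2 + 2 * (L2_norm h)\<^sup>2"
proof -
  have I: "integrable unit_ivl (\<lambda>x. (h x - g x)\<^sup>2)" "integrable unit_ivl (\<lambda>x. (h x)\<^sup>2)" "integrable unit_ivl (\<lambda>x. (g x)\<^sup>2)"
    using L2_diff[OF assms(2,1)] assms by (auto simp: L2_def)
  have "a\<^sup>2 \<le> 2 * (b - a)\<^sup>2 + 2 * b\<^sup>2" for a b :: real
    using zero_le_power2[of "a - 2 * b"] by (simp add: power2_eq_square algebra_simps)
  then have "(LINT x|unit_ivl. (g x)\<^sup>2) \<le> (LINT x|unit_ivl. 2 * (h x - g x)\<^sup>2 + 2 * (h x)\<^sup>2)"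
    using I by (intro integral_mono) auto
  then show ?thesis
    using I by (simp add: L2_norm_power2)
qed

lemma L2_norm_AE_cong:
  assumes "AE x in unit_ivl. g x = h x"
    "g \<in> borel_measurable unit_ivl" "h \<in> borel_measurable unit_ivl"
  shows "L2_norm g = L2_norm h"
  unfolding L2_norm_def using assms by (intro arg_cong[of _ _ sqrt] integral_cong_AE) auto

text \<open>Fatou's lemma for real integrals. The bound is asked for only eventually and up to every
  \<open>e\<close>, which is what an asymptotically minimizing sequence provides.\<close>

lemma integral_le_of_AE_tendsto:
  fixes u :: "nat \<Rightarrow> 'b \<Rightarrow> real"
  assumes int: "\<And>n. integrable N (u n)" "integrable N w"
    and nn: "\<And>n x. u n x \<ge> 0"
    and lim: "AE x in N. (\<lambda>n. u n x) \<longlonglongrightarrow> w x"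
    and le: "\<And>e. e > 0 \<Longrightarrow> \<forall>\<^sub>F n in sequentially. integral\<^sup>L N (u n) \<le> B + e"
  shows "integral\<^sup>L N w \<le> B"
proof (rule field_le_epsilon)
  fix e :: real assume "e > 0"
  have nnw: "AE x in N. 0 \<le> w x"
    using lim by eventually_elim (rule LIMSEQ_le_const, use nn in auto)
  have "ennreal (integral\<^sup>L N w) = (\<integral>\<^sup>+x. ennreal (w x) \<partial>N)"
    using nnw int by (simp add: nn_integral_eq_integral)
  also have "\<dots> = (\<integral>\<^sup>+x. liminf (\<lambda>n. ennreal (u n x)) \<partial>N)"
  proof (rule nn_integral_cong_AE)
    show "AE x in N. ennreal (w x) = liminf (\<lambda>n. ennreal (u n x))"
      using lim by eventually_elim (auto intro!: lim_imp_Liminf[symmetric] tendsto_ennrealI)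
  qed
  also have "\<dots> \<le> liminf (\<lambda>n. \<integral>\<^sup>+x. ennreal (u n x) \<partial>N)"
    using int by (intro nn_integral_liminf) auto
  also have "\<dots> = liminf (\<lambda>n. ennreal (integral\<^sup>L N (u n)))"
    using nn int by (simp add: nn_integral_eq_integral)
  also have "\<dots> \<le> ennreal (B + e)"
    using le[OF \<open>e > 0\<close>]
    by (intro Liminf_le) (auto elim!: eventually_mono intro: ennreal_leI)
  finally have *: "ennreal (integral\<^sup>L N w) \<le> ennreal (B + e)" .
  \<comment> \<open>\<open>ennreal\<close> truncates negative numbers to 0, so the comparison
    carries over to the reals once the right-hand side is known to be nonnegative; some integral of
    \<open>u n\<close> lies below it.\<close>
  have "0 \<le> B + e"
    using eventually_happens[OF le[OF \<open>e > 0\<close>]] Bochner_Integration.integral_nonneg[of N "u _"] nn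
    by (meson order_trans trivial_limit_sequentially)
  with * show "integral\<^sup>L N w \<le> B + e" by simp
qed

text \<open>Riesz's argument: Fatou's lemma is applied to
  \<open>2 (f - p\<^sub>n)\<^sup>2 + 2 (f - h)\<^sup>2 - (p\<^sub>n - h)\<^sup>2 \<ge> 0\<close>.\<close>
lemma L2_norm_diff_lower_bound_nonpos:
  fixes p :: "nat \<Rightarrow> real \<Rightarrow> real"
  assumes p: "\<And>n. p n \<in> L2" and h: "h \<in> L2" and f: "f \<in> L2"
    and lim: "AE x in unit_ivl. (\<lambda>n. p n x) \<longlonglongrightarrow> h x"
    and le: "\<And>e. e > 0 \<Longrightarrow> \<forall>\<^sub>F n in sequentially. (L2_norm (\<lambda>x. f x - p n x))\<^sup>2 \<le> (L2_norm (\<lambda>x. f x - h x))\<^sup>2 + e"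
    and ge: "\<And>n. (L2_norm (\<lambda>x. p n x - h x))\<^sup>2 \<ge> d"
  shows "d \<le> 0"
proof -
  define a where "a = (L2_norm (\<lambda>x. f x - h x))\<^sup>2"
  let ?u = "\<lambda>n x. 2 * (f x - p n x)\<^sup>2 + 2 * (f x - h x)\<^sup>2 - (p n x - h x)\<^sup>2"
  have I: "integrable unit_ivl (\<lambda>x. (f x - p n x)\<^sup>2)" "integrable unit_ivl (\<lambda>x. (p n x - h x)\<^sup>2)" for n
    using L2_diff[OF f p] L2_diff[OF p h] by (auto simp: L2_def)
  have Ih: "integrable unit_ivl (\<lambda>x. (f x - h x)\<^sup>2)"
    using L2_diff[OF f h] by (auto simp: L2_def)
  \<comment> \<open>The integrands converge to \<open>4 * (f - h)^2\<close>, whose integral is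
    \<open>4 * a\<close>, whereas their own integrals are eventually at most
    \<open>2 * a + 2 * a - d\<close> up to \<open>e\<close>. This leaves no room for a positive
    \<open>d\<close>.\<close>
  have "(LINT x|unit_ivl. 4 * (f x - h x)\<^sup>2) \<le> 4 * a - d"
  proof (rule integral_le_of_AE_tendsto[where u = ?u])
    show "integrable unit_ivl (?u n)" for n using I[of n] Ih by auto
    show "integrable unit_ivl (\<lambda>x. 4 * (f x - h x)\<^sup>2)" using Ih by auto
    have "0 \<le> 2 * (c - a)\<^sup>2 + 2 * (c - b)\<^sup>2 - (a - b)\<^sup>2" for a b c :: real
      using zero_le_power2[of "2 * c - a - b"] by (simp add: power2_eq_square algebra_simps)
    then show "0 \<le> ?u n x" for n x .
    show "AE x in unit_ivl. (\<lambda>n. ?u n x) \<longlonglongrightarrow> 4 * (f x - h x)\<^sup>2"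
      using lim by eventually_elim (auto intro!: tendsto_eq_intros)
    fix e :: real assume "e > 0"
    then have "\<forall>\<^sub>F n in sequentially. (L2_norm (\<lambda>x. f x - p n x))\<^sup>2 \<le> a + e / 2"
      unfolding a_def by (intro le) simp
    then show "\<forall>\<^sub>F n in sequentially. integral\<^sup>L unit_ivl (?u n) \<le> 4 * a - d + e"
    proof eventually_elim
      case (elim n)
      have "integral\<^sup>L unit_ivl (?u n) = 2 * (L2_norm (\<lambda>x. f x - p n x))\<^sup>2 + 2 * a - (L2_norm (\<lambda>x. p n x - h x))\<^sup>2"
        using I[of n] Ih by (simp add: L2_norm_power2 a_def)
      then show ?case using elim ge[of n] by simp
    qed
  qed
  then show ?thesis using Ih by (simp add: a_def L2_norm_power2)
qed

section \<open>Step functions and their jumps\<close>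

lemma step_functions_sumI:
  assumes "finite I" "\<And>i. i \<in> I \<Longrightarrow> 0 \<le> s i \<and> s i < t i \<and> t i \<le> 1"
  shows "(\<lambda>x. \<Sum>i\<in>I. c i * indicator {s i..<t i} x) \<in> step_functions"
proof -
  obtain e where e: "bij_betw e {..<card I} I"
    using ex_bij_betw_nat_finite[OF assms(1)] by (auto simp: atLeast0LessThan)
  then have *: "e k \<in> I" if "k < card I" for k
    using that by (auto simp: bij_betw_def)
  have "(\<Sum>i\<in>I. c i * indicator {s i..<t i} x) =
    (\<Sum>k<card I. c (e k) * indicator {s (e k)..<t (e k)} x)" for x
    using sum.reindex_bij_betw[OF e, of "\<lambda>i. c i * indicator {s i..<t i} x"] by simp
  then have "(\<lambda>x. \<Sum>i\<in>I. c i * indicator {s i..<t i} x) =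
    (\<lambda>x. \<Sum>k<card I. c (e k) * indicator {s (e k)..<t (e k)} x)" by (rule ext)
  moreover have "\<forall>k<card I. 0 \<le> s (e k) \<and> s (e k) < t (e k) \<and> t (e k) \<le> 1"
    using assms(2) * by blast
  ultimately show ?thesis
    unfolding step_functions_def mem_Collect_eq
    by (intro exI[of _ "card I"] exI[of _ "\<lambda>k. c (e k)"]
      exI[of _ "\<lambda>k. s (e k)"] exI[of _ "\<lambda>k. t (e k)"] conjI)
qed

lemma step_function_bounded:
  assumes "g \<in> step_functions"
  obtains B where "\<And>x. \<bar>g x\<bar> \<le> B"
proof -
  obtain m :: nat and c s t where g: "g = (\<lambda>x. \<Sum>k<m. c k * indicator {s k..<t k} x)"
    using assms by (auto simp: step_functions_def)
  have "\<bar>g x\<bar> \<le> (\<Sum>k<m. \<bar>c k\<bar>)" for x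
    unfolding g by (rule order_trans[OF sum_abs]) (auto intro!: sum_mono simp: indicator_def)
  then show ?thesis by (rule that)
qed

lemma borel_measurable_step_function:
  assumes "g \<in> step_functions"
  shows "g \<in> borel_measurable borel"
proof -
  obtain m :: nat and c s t where g: "g = (\<lambda>x. \<Sum>k<m. c k * indicator {s k..<t k} x)"
    using assms by (auto simp: step_functions_def)
  show ?thesis unfolding g by measurable
qed

lemma step_function_L2:
  assumes "g \<in> step_functions"
  shows "g \<in> L2"
  using step_function_bounded[OF assms] borel_measurable_step_function[OF assms] borel_unit_ivl L2_bounded by metis

text \<open>As \<open>y\<close> tends to \<open>x\<close> from the left, membership in
  \<open>{a..<b}\<close> settles to membership of \<open>x\<close> in \<open>{a<..b}\<close>. The
  left limit is therefore the same sum with the other endpoint included.\<close>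

lemma step_function_left:
  assumes "g \<in> step_functions"
  shows "\<exists>L. \<forall>\<^sub>F y in at_left x. g y = L"
proof -
  obtain m :: nat and c s t where g: "g = (\<lambda>x. \<Sum>k<m. c k * indicator {s k..<t k} x)"
    using assms by (auto simp: step_functions_def)
  have "\<forall>\<^sub>F y in at_left x. indicator {a..<b} y = (indicator {a<..b} x :: real)" for a b :: real
  proof -
    have "\<forall>\<^sub>F y in at_left x. y < x" by (simp add: eventually_at_filter)
    moreover have "\<forall>\<^sub>F y in at_left x. a < x \<longrightarrow> a < y"
      by (cases "a < x") (auto intro: eventually_mono[OF eventually_at_left_real])
    moreover have "\<forall>\<^sub>F y in at_left x. b < x \<longrightarrow> b < y"
      by (cases "b < x") (auto intro: eventually_mono[OF eventually_at_left_real])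
    ultimately show ?thesis
      by eventually_elim (auto simp: indicator_def)
  qed
  then have "\<forall>\<^sub>F y in at_left x. \<forall>k\<in>{..<m}. indicator {s k..<t k} y = (indicator {s k<..t k} x :: real)"
    by (intro eventually_ball_finite) auto
  then have "\<forall>\<^sub>F y in at_left x. g y = (\<Sum>k<m. c k * indicator {s k<..t k} x)"
    unfolding g by eventually_elim (auto intro!: sum.cong)
  then show ?thesis by blast
qed

lemma Lim_at_right_step_function:
  assumes "g \<in> step_functions"
  shows "Lim (at_right x) g = g x"
  using step_function_right[OF assms, of x] by (intro tendsto_Lim tendsto_eventually) auto

text \<open>\<open>jumps\<close> compares two \<open>Lim\<close> terms, which are meaningful here
  because a step function is constant close to \<open>x\<close> on either side. Without a jump the
  two constants agree, and the right one is \<open>g x\<close>.\<close>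

lemma step_function_locally_constant:
  assumes "g \<in> step_functions" "x \<in> {0<..<1}" "x \<notin> jumps g"
  shows "\<forall>\<^sub>F y in at x. g y = g x"
proof -
  obtain L where L: "\<forall>\<^sub>F y in at_left x. g y = L"
    using step_function_left[OF assms(1)] by blast
  then have "Lim (at_left x) g = L"
    by (intro tendsto_Lim tendsto_eventually) auto
  then have "L = g x"
    using assms Lim_at_right_step_function by (auto simp: jumps_def)
  then show ?thesis
    using L step_function_right[OF assms(1), of x] by (simp add: eventually_at_split)
qed

lemma locally_constant_not_jump:
  assumes "\<forall>\<^sub>F y in at x. g y = c"
  shows "x \<notin> jumps g"
proof -
  have "Lim (at_left x) g = c" "Lim (at_right x) g = c"
    using assms by (auto intro!: tendsto_Lim tendsto_eventually simp: eventually_at_split)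
  then show ?thesis by (simp add: jumps_def)
qed

lemma eventually_le_iff_nhds:
  fixes a x :: real
  assumes "a \<noteq> x"
  shows "\<forall>\<^sub>F y in nhds x. (a \<le> y \<longleftrightarrow> a \<le> x)"
proof (cases "x < a")
  case True
  then show ?thesis using order_tendstoD(2)[OF filterlim_ident True] by (auto elim!: eventually_mono)
next
  case False
  then have "a < x" using assms by auto
  then show ?thesis using order_tendstoD(1)[OF filterlim_ident, of a x] by (auto elim!: eventually_mono)
qed

lemma step_function_locally_constant_off_finite:
  assumes "g \<in> step_functions"
  obtains D where "finite D" "\<And>x. x \<notin> D \<Longrightarrow> \<forall>\<^sub>F y in at x. g y = g x"
proof -
  obtain m :: nat and c s t where g: "g = (\<lambda>x. \<Sum>k<m. c k * indicator {s k..<t k} x)"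
    using assms by (auto simp: step_functions_def)
  have "\<forall>\<^sub>F y in at x. g y = g x" if "x \<notin> s ` {..<m} \<union> t ` {..<m}" for x
  proof -
    have "\<forall>\<^sub>F y in at x. \<forall>k\<in>{..<m}. (s k \<le> y \<longleftrightarrow> s k \<le> x) \<and> (t k \<le> y \<longleftrightarrow> t k \<le> x)"
      using that by (intro eventually_ball_finite ballI eventually_conj
          filter_leD[OF at_within_le_nhds] eventually_le_iff_nhds) auto
    then show ?thesis
      unfolding g by eventually_elim (auto intro!: sum.cong simp: indicator_def not_le[symmetric])
  qed
  moreover have "finite (s ` {..<m} \<union> t ` {..<m})" by simp
  ultimately show ?thesis using that by blast
qed

lemma finite_jumps:
  assumes "g \<in> step_functions"
  shows "finite (jumps g)"
  using step_function_locally_constant_off_finite[OF assms] locally_constant_not_jump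
  by (metis finite_subset subsetI)

text \<open>Without a jump, \<open>g\<close> is locally constant on a connected interval, hence
  constant. The half-open range of \<open>t\<close> matters: such intervals are disjoint for
  different grid cells, so jumps can be counted cell by cell.\<close>

lemma jump_between:
  assumes g: "g \<in> step_functions" and ab: "0 \<le> a" "a \<le> b" "b < 1" and ne: "g a \<noteq> g b"
  shows "\<exists>t\<in>jumps g. a < t \<and> t \<le> b"
proof (rule ccontr)
  assume *: "\<not> ?thesis"
  then have no: "t \<notin> jumps g" if "a < t" "t \<le> b" for t using that * by blast
  have "g a = g b"
  proof (rule connected_local_const[of "{a..b}" a b g])
    show "\<forall>x\<in>{a..b}. \<forall>\<^sub>F y in at x within {a..b}. g x = g y"
    proof
      fix x assume x: "x \<in> {a..b}"
      show "\<forall>\<^sub>F y in at x within {a..b}. g x = g y"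
      proof (cases "x = a")
        \<comment> \<open>Within \<open>{a..b}\<close> the left endpoint is approached from the
          right only, so a jump at \<open>a\<close> itself does no harm.\<close>
        case True
        have "\<forall>\<^sub>F y in at x within {x<..}. g x = g y"
          using step_function_right[OF g, of x] by (auto elim: eventually_mono)
        moreover have "at x within {a..b} \<le> at_right x"
          unfolding at_within_def using True by (intro inf_mono order_refl) auto
        ultimately show ?thesis by (rule filter_leD[rotated])
      next
        case False
        then have "\<forall>\<^sub>F y in at x. g y = g x"
          using x ab no by (intro step_function_locally_constant g) auto
        then have "\<forall>\<^sub>F y in at x. g x = g y" by (auto elim: eventually_mono)
        then show ?thesis by (rule filter_leD[OF at_le, rotated]) auto
      qed
    qed
  qed (use ab in auto)
  then show False using ne by contradiction
qed

text \<open>Every step function with at most \<open>k\<close> jumps is of this form; the break points need be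
  neither sorted nor distinct, and some of the values may not be attained.\<close>
definition step_pattern :: "nat \<Rightarrow> (nat \<Rightarrow> real) \<Rightarrow> (nat set \<Rightarrow> real) \<Rightarrow> real \<Rightarrow> real" where
  "step_pattern k t C x = (if x \<in> {0..<1} then C {j \<in> {..<k}. t j \<le> x} else 0)"

lemma step_pattern_step_function: "step_pattern k t C \<in> step_functions"
proof -
  \<comment> \<open>\<open>{a S..<b S}\<close> is where \<open>S\<close> is exactly the set of break
    points passed: it starts at the last break point in \<open>S\<close> and ends at the first one
    outside. The inserted 0 and 1 confine it to the unit interval. Different sets have disjoint
    intervals, so the sum below has at most one nonzero term.\<close>
  define a where "a S = Max (insert 0 (t ` S))" for S
  define b where "b S = Min (insert 1 (t ` ({..<k} - S)))" for S
  define I where "I = {S \<in> Pow {..<k}. a S < b S}"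
  have mem: "x \<in> {a S..<b S} \<longleftrightarrow> x \<in> {0..<1} \<and> S = {j \<in> {..<k}. t j \<le> x}" if "S \<subseteq> {..<k}" for S x
  proof -
    have "finite S" using that finite_subset by blast
    then have "x \<in> {a S..<b S} \<longleftrightarrow> x \<in> {0..<1} \<and> (\<forall>j\<in>S. t j \<le> x) \<and> (\<forall>j\<in>{..<k} - S. x < t j)"
      unfolding a_def b_def by auto
    moreover have "S = {j \<in> {..<k}. t j \<le> x} \<longleftrightarrow> (\<forall>j\<in>S. t j \<le> x) \<and> (\<forall>j\<in>{..<k} - S. \<not> t j \<le> x)"
      using that by blast
    ultimately show ?thesis unfolding not_le by blast
  qed
  have "step_pattern k t C x = (\<Sum>S\<in>I. C S * indicator {a S..<b S} x)" for x
  proof -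
    let ?S = "{j \<in> {..<k}. t j \<le> x}"
    have "(\<Sum>S\<in>I. C S * indicator {a S..<b S} x) =
      (\<Sum>S\<in>I. if S = ?S then (if x \<in> {0..<1} then C S else 0) else 0)"
    proof (rule sum.cong[OF refl])
      fix S assume "S \<in> I"
      then have "S \<subseteq> {..<k}" by (simp add: I_def)
      then show "C S * indicator {a S..<b S} x = (if S = ?S then (if x \<in> {0..<1} then C S else 0) else 0)"
      proof (cases "x \<in> {a S..<b S}")
        case True
        then have "x \<in> {0..<1}" "S = ?S" using mem[OF \<open>S \<subseteq> {..<k}\<close>] by blast+
        then have "(if S = ?S then (if x \<in> {0..<1} then C S else 0) else 0) = C S"
          by (simp only: if_True simp_thms)
        then show ?thesis using True by (simp only: indicator_simps mult_1_right)
      next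
        case False
        then have "\<not> (x \<in> {0..<1} \<and> S = ?S)" using mem[OF \<open>S \<subseteq> {..<k}\<close>] by blast
        then have "(if S = ?S then (if x \<in> {0..<1} then C S else 0) else 0) = 0"
          by (simp only: split: if_split) blast
        then show ?thesis using False by (simp only: indicator_simps mult_zero_right simp_thms not_False_eq_True)
      qed
    qed
    also have "\<dots> = (if ?S \<in> I then (if x \<in> {0..<1} then C ?S else 0) else 0)"
      by (rule sum.delta) (simp add: I_def)
    also have "\<dots> = step_pattern k t C x"
    proof -
      have "?S \<in> I" if "x \<in> {0..<1}"
      proof -
        have "?S \<subseteq> {..<k}" by blast
        then have "x \<in> {a ?S..<b ?S}" using mem that by blast
        then show ?thesis by (auto simp: I_def)
      qed
      then show ?thesis unfolding step_pattern_def by presburger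
    qed
    finally show ?thesis ..
  qed
  then have "step_pattern k t C = (\<lambda>x. \<Sum>S\<in>I. C S * indicator {a S..<b S} x)" by auto
  also have "\<dots> \<in> step_functions"
  proof (rule step_functions_sumI)
    show "finite I" by (simp add: I_def)
    show "0 \<le> a S \<and> a S < b S \<and> b S \<le> 1" if "S \<in> I" for S
    proof -
      have "finite S" using that finite_subset unfolding I_def by blast
      then show ?thesis using that by (auto simp: I_def a_def b_def)
    qed
  qed
  finally show ?thesis .
qed

lemma jumps_step_pattern: "jumps (step_pattern k t C) \<subseteq> t ` {..<k}"
proof
  fix x assume x: "x \<in> jumps (step_pattern k t C)"
  show "x \<in> t ` {..<k}"
  proof (rule ccontr)
    assume "x \<notin> t ` {..<k}"
    then have "\<forall>\<^sub>F y in at x. \<forall>j\<in>{..<k}. (t j \<le> y \<longleftrightarrow> t j \<le> x)"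
      by (intro eventually_ball_finite ballI filter_leD[OF at_within_le_nhds] eventually_le_iff_nhds) auto
    moreover have "\<forall>\<^sub>F y in at x. y \<in> {0<..<1}"
      using x by (intro filter_leD[OF at_within_le_nhds] eventually_nhds_in_open) (auto simp: jumps_def)
    ultimately have "\<forall>\<^sub>F y in at x. step_pattern k t C y = C {j \<in> {..<k}. t j \<le> x}"
    proof eventually_elim
      case (elim y)
      then have "{j \<in> {..<k}. t j \<le> y} = {j \<in> {..<k}. t j \<le> x}" by auto
      then show ?case using elim by (simp add: step_pattern_def)
    qed
    then show False using x locally_constant_not_jump by blast
  qed
qed

lemma card_jumps_step_pattern: "card (jumps (step_pattern k t C)) \<le> k"
  using card_mono[OF _ jumps_step_pattern] card_image_le[of "{..<k}" t]
  by (metis card_lessThan finite_imageI finite_lessThan le_trans)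

section \<open>Compactness and minimizing sequences\<close>

text \<open>Bolzano-Weierstrass for one index after the other; passing to a further subsequence
  keeps the limits already obtained.\<close>

lemma finite_family_convergent_subseq:
  fixes X :: "'i \<Rightarrow> nat \<Rightarrow> real"
  assumes "finite I" "\<And>i. i \<in> I \<Longrightarrow> Bseq (X i)"
  shows "\<exists>r. strict_mono r \<and> (\<forall>i\<in>I. convergent (X i \<circ> r))"
  using assms
proof (induction I rule: finite_induct)
  case empty
  show ?case using strict_mono_id by auto
next
  case (insert i I)
  then obtain r where r: "strict_mono r" "\<forall>i\<in>I. convergent (X i \<circ> r)" by blast
  have "bounded (range (X i \<circ> r))"
    using insert.prems[of i] by (auto simp: Bseq_eq_bounded elim!: bounded_subset)
  then obtain l r' where r': "strict_mono r'" "((X i \<circ> r) \<circ> r') \<longlonglongrightarrow> l"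
    using bounded_imp_convergent_subsequence by blast
  have "convergent (X j \<circ> (r \<circ> r'))" if "j \<in> insert i I" for j
    using that r r' convergent_subseq_convergent[of "X j \<circ> r" r']
    unfolding o_assoc convergent_def by blast
  then show ?case using strict_mono_o[OF r(1) r'(1)] by blast
qed

text \<open>The fixed width of the neighbourhood later bounds the values on the piece containing
  \<open>x\<close>, and the eventually fixed index set gives pointwise convergence at
  \<open>x\<close>.\<close>

lemma step_pattern_stable:
  fixes T :: "nat \<Rightarrow> real" and t :: "nat \<Rightarrow> nat \<Rightarrow> real"
  assumes x: "x \<in> {0<..<1}" "\<And>j. j < k \<Longrightarrow> T j \<noteq> x"
    and lim: "\<And>j. j < k \<Longrightarrow> (\<lambda>n. t n j) \<longlonglongrightarrow> T j"
  obtains \<eta> where "\<eta> > 0" "{x - \<eta><..<x + \<eta>} \<subseteq> {0<..<1}"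
    "\<forall>\<^sub>F n in sequentially. \<forall>y\<in>{x - \<eta><..<x + \<eta>}. {j \<in> {..<k}. t n j \<le> y} = {j \<in> {..<k}. T j \<le> x}"
proof -
  let ?Z = "insert x (insert (1 - x) ((\<lambda>j. \<bar>T j - x\<bar>) ` {..<k}))"
  \<comment> \<open>Half the least distance from \<open>x\<close> to 0, 1 and the limits: a break
    point that is \<open>\<eta>\<close>-close to its limit cannot change sides relative to a
    \<open>y\<close> that is \<open>\<eta>\<close>-close to \<open>x\<close>.\<close>
  define \<eta> where "\<eta> = Min ?Z / 2"
  have "2 * \<eta> \<le> z" if "z \<in> ?Z" for z
    unfolding \<eta>_def using Min_le[OF _ that] by simp
  then have "2 * \<eta> \<le> x" "2 * \<eta> \<le> 1 - x" and sep: "\<And>j. j < k \<Longrightarrow> 2 * \<eta> \<le> \<bar>T j - x\<bar>"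
    by blast+
  have "\<eta> > 0"
    using x by (auto simp: \<eta>_def)
  have "\<forall>\<^sub>F n in sequentially. \<forall>j\<in>{..<k}. dist (t n j) (T j) < \<eta>"
    using lim \<open>\<eta> > 0\<close> by (intro eventually_ball_finite ballI tendstoD) auto
  then have "\<forall>\<^sub>F n in sequentially. \<forall>y\<in>{x - \<eta><..<x + \<eta>}. {j \<in> {..<k}. t n j \<le> y} = {j \<in> {..<k}. T j \<le> x}"
  proof eventually_elim
    case (elim n)
    have "t n j \<le> y \<longleftrightarrow> T j \<le> x" if "j < k" "y \<in> {x - \<eta><..<x + \<eta>}" for j y
    proof -
      have "\<bar>t n j - T j\<bar> < \<eta>" using elim that by (auto simp: dist_real_def)
      then show ?thesis using sep[OF that(1)] that(2) by (auto simp: abs_if split: if_splits)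
    qed
    then show ?case by auto
  qed
  moreover have "{x - \<eta><..<x + \<eta>} \<subseteq> {0<..<1}"
    using \<open>2 * \<eta> \<le> x\<close> \<open>2 * \<eta> \<le> 1 - x\<close> \<open>\<eta> > 0\<close> by auto
  ultimately show ?thesis using that \<open>\<eta> > 0\<close> by blast
qed

lemma L2_norm_ge_interval:
  assumes g: "g \<in> L2" and sub: "{x - \<eta><..<x + \<eta>} \<subseteq> {0<..<1}" and "\<eta> > 0"
    and c: "\<And>y. y \<in> {x - \<eta><..<x + \<eta>} \<Longrightarrow> g y = c"
  shows "c\<^sup>2 * (2 * \<eta>) \<le> (L2_norm g)\<^sup>2"
proof -
  let ?A = "{x - \<eta><..<x + \<eta>}"
  have A: "?A \<in> sets unit_ivl" "measure unit_ivl ?A = 2 * \<eta>"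
  proof -
    have "?A \<subseteq> {0..<1}" using sub by force
    then show "?A \<in> sets unit_ivl" "measure unit_ivl ?A = 2 * \<eta>"
      using \<open>\<eta> > 0\<close> by (auto simp: sets_restrict_space_iff measure_restrict_space)
  qed
  have int: "integrable unit_ivl (indicator ?A :: real \<Rightarrow> real)"
    using A finite_measure.emeasure_finite[OF unit_ivl_finite_measure, of ?A]
    by (intro integrable_real_indicator) (auto simp: less_top)
  have "c\<^sup>2 * (2 * \<eta>) = (LINT y|unit_ivl. c\<^sup>2 * indicator ?A y)"
    using int A sets.sets_into_space[OF A(1)] by (simp add: Int_absorb2)
  also have "\<dots> \<le> (LINT y|unit_ivl. (g y)\<^sup>2)"
  proof (rule integral_mono)
    show "integrable unit_ivl (\<lambda>y. c\<^sup>2 * indicator ?A y)" using int by simp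
    show "integrable unit_ivl (\<lambda>y. (g y)\<^sup>2)" using g by (simp add: L2_def)
    show "c\<^sup>2 * indicator ?A y \<le> (g y)\<^sup>2" for y
      using c[of y] by (cases "y \<in> ?A") auto
  qed
  finally show ?thesis by (simp add: L2_norm_power2)
qed

text \<open>The norm bound controls the value on every piece that does not shrink to a point;
  the other values are irrelevant in the limit.\<close>
lemma step_pattern_compact:
  fixes t :: "nat \<Rightarrow> nat \<Rightarrow> real"
  assumes t: "\<And>n j. t n j \<in> {0..1}"
    and R: "\<And>n. (L2_norm (step_pattern k (t n) (C n)))\<^sup>2 \<le> R"
  obtains r h D where "strict_mono r" "h \<in> step_functions" "card (jumps h) \<le> k" "finite D"
    "\<And>x. x \<notin> D \<Longrightarrow> (\<lambda>n. step_pattern k (t (r n)) (C (r n)) x) \<longlonglongrightarrow> h x"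
proof -
  have "Bseq (\<lambda>n. t n j)" for j
    using t[of _ j] by (intro BseqI'[of _ 1]) auto
  then obtain r1 where r1: "strict_mono r1" "\<And>j. j \<in> {..<k} \<Longrightarrow> convergent ((\<lambda>n. t n j) \<circ> r1)"
    using finite_family_convergent_subseq[of "{..<k}" "\<lambda>j n. t n j"] by auto
  define T where "T j = lim ((\<lambda>n. t n j) \<circ> r1)" for j
  have T: "(\<lambda>n. t (r1 n) j) \<longlonglongrightarrow> T j" if "j < k" for j
    using r1(2)[of j] that unfolding T_def by (simp add: convergent_LIMSEQ_iff o_def)
  \<comment> \<open>\<open>rel S\<close> says that the piece of \<open>S\<close> keeps positive
    length in the limit. Values on vanishing pieces may be unbounded, so \<open>X\<close> replaces
    them by 0; they are not seen at points off the limiting break points.\<close>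
  define rel where "rel S \<longleftrightarrow> (\<exists>x\<in>{0<..<1}. (\<forall>j<k. T j \<noteq> x) \<and> S = {j \<in> {..<k}. T j \<le> x})" for S
  define X where "X S n = (if rel S then C (r1 n) S else 0)" for S n
  have "Bseq (X S)" for S
  proof (cases "rel S")
    case True
    then obtain x where x: "x \<in> {0<..<1}" "\<And>j. j < k \<Longrightarrow> T j \<noteq> x" and S: "S = {j \<in> {..<k}. T j \<le> x}"
      unfolding rel_def by blast
    obtain \<eta> where \<eta>: "\<eta> > 0" "{x - \<eta><..<x + \<eta>} \<subseteq> {0<..<1}"
      and ev: "\<forall>\<^sub>F n in sequentially. \<forall>y\<in>{x - \<eta><..<x + \<eta>}. {j \<in> {..<k}. t (r1 n) j \<le> y} = {j \<in> {..<k}. T j \<le> x}"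
      by (rule step_pattern_stable[of x k T "\<lambda>n. t (r1 n)", OF x T])
    have "\<forall>\<^sub>F n in sequentially. norm (X S n) \<le> sqrt (R / (2 * \<eta>))"
      using ev
    proof eventually_elim
      case (elim n)
      have "(C (r1 n) S)\<^sup>2 * (2 * \<eta>) \<le> (L2_norm (step_pattern k (t (r1 n)) (C (r1 n))))\<^sup>2"
      proof (rule L2_norm_ge_interval[OF step_function_L2[OF step_pattern_step_function] \<eta>(2,1)])
        fix y assume y: "y \<in> {x - \<eta><..<x + \<eta>}"
        then have "y \<in> {0..<1}" using \<eta>(2) by force
        then show "step_pattern k (t (r1 n)) (C (r1 n)) y = C (r1 n) S"
          using elim y unfolding step_pattern_def S by simp
      qed
      also have "\<dots> \<le> R" by (rule R)
      finally have "(C (r1 n) S)\<^sup>2 \<le> R / (2 * \<eta>)" using \<eta>(1) by (simp add: field_simps)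
      then show ?case using True real_le_rsqrt[of "\<bar>C (r1 n) S\<bar>"] by (simp add: X_def)
    qed
    then show ?thesis by (rule BfunI)
  next
    case False
    then have "X S = (\<lambda>_. 0)" by (auto simp: X_def)
    then show ?thesis by simp
  qed
  then obtain r2 where r2: "strict_mono r2" "\<And>S. S \<in> Pow {..<k} \<Longrightarrow> convergent (X S \<circ> r2)"
    using finite_family_convergent_subseq[of "Pow {..<k}" X] by auto
  define L where "L S = lim (X S \<circ> r2)" for S
  have L: "(\<lambda>n. X S (r2 n)) \<longlonglongrightarrow> L S" if "S \<subseteq> {..<k}" for S
    using r2(2)[of S] that unfolding L_def by (simp add: convergent_LIMSEQ_iff o_def)
  show ?thesis
  proof (rule that)
    show "strict_mono (r1 \<circ> r2)" using r1 r2 by (intro strict_mono_o)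
    show "step_pattern k T L \<in> step_functions" by (rule step_pattern_step_function)
    show "card (jumps (step_pattern k T L)) \<le> k" by (rule card_jumps_step_pattern)
    \<comment> \<open>The point 0 is excluded as well because \<open>step_pattern_stable\<close>
      works at interior points.\<close>
    show "finite (insert 0 (T ` {..<k}))" by simp
    fix x assume x: "x \<notin> insert 0 (T ` {..<k})"
    show "(\<lambda>n. step_pattern k (t ((r1 \<circ> r2) n)) (C ((r1 \<circ> r2) n)) x) \<longlonglongrightarrow> step_pattern k T L x"
    proof (cases "x \<in> {0..<1}")
      case True
      then have x': "x \<in> {0<..<1}" "\<And>j. j < k \<Longrightarrow> T j \<noteq> x" using x by (auto simp: less_le)
      let ?S = "{j \<in> {..<k}. T j \<le> x}"
      have "rel ?S" unfolding rel_def using x' by blast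
      obtain \<eta> where \<eta>: "\<eta> > 0" and "{x - \<eta><..<x + \<eta>} \<subseteq> {0<..<1}"
        and ev: "\<forall>\<^sub>F n in sequentially. \<forall>y\<in>{x - \<eta><..<x + \<eta>}. {j \<in> {..<k}. t (r1 n) j \<le> y} = ?S"
        by (rule step_pattern_stable[of x k T "\<lambda>n. t (r1 n)", OF x' T])
      from ev have "\<forall>\<^sub>F n in sequentially. {j \<in> {..<k}. t (r1 n) j \<le> x} = ?S"
        using \<eta> by (auto elim!: eventually_mono)
      then have "\<forall>\<^sub>F n in sequentially. {j \<in> {..<k}. t (r1 (r2 n)) j \<le> x} = ?S"
        by (rule eventually_compose_filterlim[OF _ filterlim_subseq[OF r2(1)]])
      then have "\<forall>\<^sub>F n in sequentially. X ?S (r2 n) = step_pattern k (t ((r1 \<circ> r2) n)) (C ((r1 \<circ> r2) n)) x"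
      proof eventually_elim
        case (elim n)
        then show ?case using True \<open>rel ?S\<close> unfolding X_def step_pattern_def o_def by simp
      qed
      then have "(\<lambda>n. step_pattern k (t ((r1 \<circ> r2) n)) (C ((r1 \<circ> r2) n)) x) \<longlonglongrightarrow> L ?S"
        by (rule Lim_transform_eventually[OF L, rotated]) blast
      then show ?thesis using True by (simp only: step_pattern_def if_True)
    next
      case False
      then show ?thesis by (simp only: step_pattern_def if_False tendsto_const)
    qed
  qed
qed

lemma AE_unit_ivl_not_finite:
  assumes "finite D"
  shows "AE x in unit_ivl. x \<notin> D"
proof -
  have "AE x in lebesgue. x \<notin> D"
    using negligible_finite[OF assms] by (intro AE_not_in) (simp add: negligible_iff_null_sets)
  then show ?thesis by (simp add: AE_restrict_space_iff) (auto elim: eventually_mono)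
qed

text \<open>Here \<open>k n\<close> is the number of break points used for \<open>p n\<close>, an
  upper bound for the number of its jumps. The argument is by contradiction, along a subsequence
  that stays at distance at least \<open>e\<close> from \<open>g\<close>.\<close>

lemma minimizing_sequence_converges:
  fixes f g :: "real \<Rightarrow> real" and k :: "nat \<Rightarrow> nat"
  assumes f: "f \<in> L2" and g: "g \<in> L2" and \<gamma>: "\<gamma> > 0"
    and min: "\<And>h. h \<in> step_functions \<Longrightarrow> m \<le> \<gamma> * real (card (jumps h)) + (L2_norm (\<lambda>x. f x - h x))\<^sup>2"
    and uniq: "\<And>h. h \<in> step_functions \<Longrightarrow>
      \<gamma> * real (card (jumps h)) + (L2_norm (\<lambda>x. f x - h x))\<^sup>2 \<le> m \<Longrightarrow> L2_eq h g"
    and t: "\<And>n j. t n j \<in> {0..1}"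
    and p: "\<And>n. p n = step_pattern (k n) (t n) (C n)"
    and le: "\<And>e. e > 0 \<Longrightarrow> \<forall>\<^sub>F n in sequentially. \<gamma> * real (k n) + (L2_norm (\<lambda>x. f x - p n x))\<^sup>2 \<le> m + e"
  shows "(\<lambda>n. L2_norm (\<lambda>x. p n x - g x)) \<longlonglongrightarrow> 0"
proof (rule ccontr)
  assume "\<not> ?thesis"
  then obtain e where e: "e > 0" and "\<not> (\<forall>\<^sub>F n in sequentially. dist (L2_norm (\<lambda>x. p n x - g x)) 0 < e)"
    unfolding tendsto_iff by blast
  then have fr: "\<exists>\<^sub>F n in sequentially. e \<le> L2_norm (\<lambda>x. p n x - g x)"
    by (simp add: not_eventually not_less L2_norm_def)
  \<comment> \<open>Membership in \<open>A\<close> bounds the penalty, so \<open>k\<close> takes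
    finitely many values on the infinite set \<open>A\<close> and is constant along a subsequence.
    Compactness can then be used with a fixed number of break points.\<close>
  define A where "A = {n. e \<le> L2_norm (\<lambda>x. p n x - g x) \<and> \<gamma> * real (k n) + (L2_norm (\<lambda>x. f x - p n x))\<^sup>2 \<le> m + 1}"
  have "\<exists>\<^sub>F n in sequentially. n \<in> A"
    using frequently_eventually_conj[OF fr le[of 1]] by (auto simp: A_def conj_commute elim: frequently_elim1)
  then have "infinite A"
    by (simp add: frequently_cofinite flip: cofinite_eq_sequentially)
  moreover have "finite (k ` A)"
  proof (rule finite_subset)
    show "k ` A \<subseteq> {..nat \<lceil>(m + 1) / \<gamma>\<rceil>}"
    proof safe
      fix n assume "n \<in> A"
      then have "\<gamma> * real (k n) \<le> m + 1" unfolding A_def using zero_le_power2[of "L2_norm (\<lambda>x. f x - p n x)"]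
        unfolding mem_Collect_eq by linarith
      then have "real (k n) \<le> (m + 1) / \<gamma>" using \<gamma> by (simp add: field_simps)
      then show "k n \<le> nat \<lceil>(m + 1) / \<gamma>\<rceil>" by linarith
    qed
  qed simp
  ultimately obtain n0 where "infinite {n \<in> A. k n = k n0}"
    using pigeonhole_infinite[of A k] by blast
  from infinite_enumerate[OF this] obtain s :: "nat \<Rightarrow> nat" where
    "strict_mono s \<and> (\<forall>n. s n \<in> {n \<in> A. k n = k n0})" ..
  then have s: "strict_mono s" "\<And>n. s n \<in> A" "\<And>n. k (s n) = k n0" by simp_all
  define k0 where "k0 = k n0"
  have sA: "s n \<in> A" and sk: "p (s n) = step_pattern k0 (t (s n)) (C (s n))" "k (s n) = k0" for n
    using s(2,3)[of n] p[of "s n"] by (simp_all add: k0_def)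
  have pstep: "p n \<in> step_functions" for n unfolding p by (rule step_pattern_step_function)
  have "(L2_norm (step_pattern k0 (t (s n)) (C (s n))))\<^sup>2 \<le> 2 * (m + 1) + 2 * (L2_norm f)\<^sup>2" for n
  proof -
    have "0 \<le> \<gamma> * real (k (s n))" using \<gamma> by simp
    then have "(L2_norm (\<lambda>x. f x - p (s n) x))\<^sup>2 \<le> m + 1" using sA[of n] unfolding A_def by auto
    then show ?thesis
      using L2_norm_sq_triangle[OF step_function_L2[OF pstep[of "s n"]] f] unfolding sk by simp
  qed
  from step_pattern_compact[of "\<lambda>n. t (s n)" k0 "\<lambda>n. C (s n)", OF t this] obtain r h D where
    r: "strict_mono r" and h: "h \<in> step_functions" "card (jumps h) \<le> k0" and D: "finite D"
    "\<And>x. x \<notin> D \<Longrightarrow> (\<lambda>n. step_pattern k0 (t (s (r n))) (C (s (r n))) x) \<longlonglongrightarrow> h x"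
    by blast
  define q where "q n = p (s (r n))" for n
  have qL: "q n \<in> L2" and hL: "h \<in> L2" for n unfolding q_def using pstep h step_function_L2 by auto
  have lim: "AE x in unit_ivl. (\<lambda>n. q n x) \<longlonglongrightarrow> h x"
    using AE_unit_ivl_not_finite[OF D(1)] by eventually_elim (simp add: q_def sk D(2))
  have sr: "strict_mono (s \<circ> r)" using s(1) r by (rule strict_mono_o)
  have qle: "\<forall>\<^sub>F n in sequentially. (L2_norm (\<lambda>x. f x - q n x))\<^sup>2 \<le> m - \<gamma> * real k0 + e" if "e > 0" for e
    using eventually_compose_filterlim[OF le[OF that] filterlim_subseq[OF sr]]
    by eventually_elim (auto simp: q_def sk o_def)
  have "(LINT x|unit_ivl. (f x - h x)\<^sup>2) \<le> m - \<gamma> * real k0"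
  proof (rule integral_le_of_AE_tendsto[where u = "\<lambda>n x. (f x - q n x)\<^sup>2"])
    show "integrable unit_ivl (\<lambda>x. (f x - q n x)\<^sup>2)" "integrable unit_ivl (\<lambda>x. (f x - h x)\<^sup>2)" for n
      using L2_diff[OF f qL] L2_diff[OF f hL] by (auto simp: L2_def)
    show "AE x in unit_ivl. (\<lambda>n. (f x - q n x)\<^sup>2) \<longlonglongrightarrow> (f x - h x)\<^sup>2"
      using lim by eventually_elim (auto intro!: tendsto_intros)
  qed (use qle in \<open>auto simp: L2_norm_power2\<close>)
  then have hle: "(L2_norm (\<lambda>x. f x - h x))\<^sup>2 \<le> m - \<gamma> * real k0" by (simp add: L2_norm_power2)
  have mono: "\<gamma> * real (card (jumps h)) \<le> \<gamma> * real k0" using h(2) \<gamma> by simp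
  have hg: "L2_eq h g" by (rule uniq[OF h(1)]) (use hle mono in linarith)
  \<comment> \<open>With \<open>hle\<close> this is an equality: by minimality of \<open>m\<close>,
    the limit cannot fit better than \<open>m - \<gamma> * k0\<close>. The fits along the
    subsequence are thus eventually at most \<open>e\<close> above that of \<open>h\<close>, which
    upgrades pointwise to strong convergence.\<close>
  have hge: "m - \<gamma> * real k0 \<le> (L2_norm (\<lambda>x. f x - h x))\<^sup>2" using min[OF h(1)] mono by linarith
  have "e\<^sup>2 \<le> 0"
  proof (rule L2_norm_diff_lower_bound_nonpos[OF qL hL f lim])
    show "\<forall>\<^sub>F n in sequentially. (L2_norm (\<lambda>x. f x - q n x))\<^sup>2 \<le> (L2_norm (\<lambda>x. f x - h x))\<^sup>2 + e" if "e > 0" for e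
      using qle[OF that] by eventually_elim (use hge in linarith)
    fix n
    have "L2_norm (\<lambda>x. q n x - h x) = L2_norm (\<lambda>x. q n x - g x)"
    proof (rule L2_norm_AE_cong)
      show "AE x in unit_ivl. q n x - h x = q n x - g x"
        using hg unfolding L2_eq_def by eventually_elim simp
    qed (use qL[of n] hL g in \<open>auto simp: L2_def\<close>)
    moreover have "e \<le> L2_norm (\<lambda>x. q n x - g x)" using sA[of "r n"] by (simp add: A_def q_def)
    ultimately show "e\<^sup>2 \<le> (L2_norm (\<lambda>x. q n x - h x))\<^sup>2" using e by (simp add: power_mono)
  qed
  then show False using e by simp
qed

section \<open>Discretisation and noise\<close>

lemma grid_index:
  fixes x :: real
  assumes "n \<ge> 1" "x \<in> {0..<1}"
  obtains i where "i \<in> {1..n}" "x \<in> {(real i - 1) / real n..<real i / real n}"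
proof
  let ?i = "nat \<lfloor>x * real n\<rfloor> + 1"
  have le: "real (?i - 1) \<le> x * real n" "x * real n < real ?i"
    using assms floor_correct[of "x * real n"] by (auto simp: of_nat_nat add.commute)
  have "x * real n < real n" using assms by simp
  then show "?i \<in> {1..n}" using le by (simp add: nat_less_iff floor_less_iff Suc_le_eq)
  show "x \<in> {(real ?i - 1) / real n..<real ?i / real n}"
    using le assms by (simp add: field_simps)
qed

lemma grid_subset:
  assumes "i \<in> {1..n}"
  shows "{(real i - 1) / real n..<real i / real n} \<subseteq> {0..<1}"
proof
  fix x assume x: "x \<in> {(real i - 1) / real n..<real i / real n}"
  have "0 \<le> (real i - 1) / real n" "real i / real n \<le> 1"
    using assms by (auto simp: field_simps)
  then show "x \<in> {0..<1}" using x by auto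
qed

lemma grid_unique:
  fixes x :: real
  assumes "i \<in> {1..n}" "j \<in> {1..n}"
    "x \<in> {(real i - 1) / real n..<real i / real n}" "x \<in> {(real j - 1) / real n..<real j / real n}"
  shows "i = j"
proof -
  have "real i - 1 < real j" "real j - 1 < real i"
    using assms by (auto simp: field_simps)
  then show ?thesis by linarith
qed

lemma step_embed_eq:
  assumes "i \<in> {1..n}" "x \<in> {(real i - 1) / real n..<real i / real n}"
  shows "step_embed n u x = u i"
proof -
  have "step_embed n u x = (\<Sum>j=1..n. if j = i then u j else 0)"
    unfolding step_embed_def
  proof (rule sum.cong[OF refl])
    fix j assume "j \<in> {1..n}"
    then have "x \<in> {(real j - 1) / real n..<real j / real n} \<longleftrightarrow> j = i"
      using grid_unique[OF _ assms(1) _ assms(2)] assms by blast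
    then show "u j * indicator {(real j - 1) / real n..<real j / real n} x = (if j = i then u j else 0)"
      by (simp add: indicator_def del: atLeastLessThan_iff)
  qed
  then show ?thesis using assms by simp
qed

lemma step_embed_outside:
  assumes "x \<notin> {0..<1}"
  shows "step_embed n u x = 0"
proof -
  have "x \<notin> {(real i - 1) / real n..<real i / real n}" if "i \<in> {1..n}" for i
    using grid_subset[OF that] assms by blast
  then show ?thesis unfolding step_embed_def by (intro sum.neutral) (auto simp: indicator_def)
qed

lemma step_embed_step_function: "step_embed n u \<in> step_functions"
  unfolding step_embed_def
proof (rule step_functions_sumI)
  fix i assume i: "i \<in> {1..n}"
  then have "1 \<le> real i" "real i \<le> real n" "0 < real n" by auto
  then show "0 \<le> (real i - 1) / real n \<and> (real i - 1) / real n < real i / real n \<and> real i / real n \<le> 1"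
    by (intro conjI divide_nonneg_pos divide_strict_right_mono) auto
qed simp

text \<open>Pairing with a grid step function sees only the integrals of \<open>f\<close> over the
  cells, so \<open>f\<close> and its local means are interchangeable here.\<close>

lemma LINT_step_embed_mult:
  assumes "n \<ge> 1" and f: "integrable unit_ivl f"
  shows "(LINT x|unit_ivl. step_embed n u x * f x) = (\<Sum>i=1..n. u i * local_mean f i n) / real n"
proof -
  let ?I = "\<lambda>i. {(real i - 1) / real n..<real i / real n}"
  have int: "integrable unit_ivl (\<lambda>x. indicator (?I i) x * f x)" for i
  proof (rule Bochner_Integration.integrable_bound[OF f])
    show "(\<lambda>x. indicator (?I i) x * f x) \<in> borel_measurable unit_ivl"
      by (intro borel_measurable_times borel_measurable_integrable[OF f] borel_unit_ivl) auto
  qed (auto simp: indicator_def)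
  have loc: "(LINT x|unit_ivl. indicator (?I i) x * f x) = local_mean f i n / real n" if "i \<in> {1..n}" for i
  proof -
    have *: "indicator {0..<1} x * (indicator (?I i) x * f x) = indicator (?I i) x * f x" for x :: real
      using grid_subset[OF that] by (auto simp: indicator_def)
    have "(LINT x|unit_ivl. indicator (?I i) x * f x) =
        (LINT x|lebesgue. indicator {0..<1} x * (indicator (?I i) x * f x))"
      by (subst integral_restrict_space) auto
    then show ?thesis
      unfolding * using assms(1) by (simp add: local_mean_def set_lebesgue_integral_def)
  qed
  have "(LINT x|unit_ivl. step_embed n u x * f x) = (LINT x|unit_ivl. (\<Sum>i=1..n. u i * (indicator (?I i) x * f x)))"
    by (simp only: step_embed_def sum_distrib_right mult.assoc)
  also have "\<dots> = (\<Sum>i=1..n. u i * (local_mean f i n / real n))"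
    using int loc by (subst Bochner_Integration.integral_sum) auto
  finally show ?thesis by (simp add: sum_divide_distrib)
qed

lemma L2_norm_step_embed:
  assumes "n \<ge> 1"
  shows "(L2_norm (step_embed n u))\<^sup>2 = (\<Sum>i=1..n. (u i)\<^sup>2) / real n"
proof -
  \<comment> \<open>Each point of the unit interval lies in one cell, so squaring acts on the
    coefficients. The factor 1 puts the integral in the form of \<open>LINT_step_embed_mult\<close>
    for the constant function 1.\<close>
  have sq: "(step_embed n u x)\<^sup>2 = step_embed n (\<lambda>i. (u i)\<^sup>2) x * 1" for x
  proof (cases "x \<in> {0..<1}")
    case True
    then obtain i where "i \<in> {1..n}" "x \<in> {(real i - 1) / real n..<real i / real n}"
      using grid_index assms by blast
    then show ?thesis by (simp add: step_embed_eq)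
  qed (simp add: step_embed_outside)
  have "local_mean (\<lambda>_. 1) i n = 1" if "i \<in> {1..n}" for i
    using that assms unfolding local_mean_def set_lebesgue_integral_def
    by (simp add: divide_right_mono field_simps)
  then show ?thesis
    unfolding L2_norm_power2 sq using assms
    by (subst LINT_step_embed_mult) (auto intro: integrable_unit_ivl_bounded[of _ 1])
qed

lemma L2_imp_integrable:
  assumes "f \<in> L2"
  shows "integrable unit_ivl f"
  using L2_mult_integrable[OF assms L2_bounded[of "\<lambda>_. 1" 1]] by simp

text \<open>Both squares are expanded, and \<open>LINT_step_embed_mult\<close> matches their cross
  terms. The last bracket does not involve \<open>u\<close> and cancels when two vectors are
  compared.\<close>

lemma H_fin_eq:
  assumes "n \<ge> 1" "f \<in> L2"
  shows "H_fin n g u (\<lambda>i. observation f \<xi> i n \<omega>) =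
    g * real (card {i. 1 \<le> i \<and> i \<le> n - 1 \<and> u i \<noteq> u (i + 1)})
    + (L2_norm (\<lambda>x. f x - step_embed n u x))\<^sup>2 - 2 / real n * (\<Sum>i=1..n. u i * \<xi> i n \<omega>)
    + ((\<Sum>i=1..n. (observation f \<xi> i n \<omega>)\<^sup>2) / real n - (L2_norm f)\<^sup>2)"
proof -
  let ?S = "\<Sum>i=1..n. u i * local_mean f i n" and ?N = "\<Sum>i=1..n. u i * \<xi> i n \<omega>"
    and ?Q = "\<Sum>i=1..n. (u i)\<^sup>2" and ?Y = "\<Sum>i=1..n. (observation f \<xi> i n \<omega>)\<^sup>2"
  have "(L2_norm (\<lambda>x. f x - step_embed n u x))\<^sup>2 = (L2_norm f)\<^sup>2 - 2 * (?S / real n) + ?Q / real n"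
    using L2_norm_sq_diff[OF assms(2) step_function_L2[OF step_embed_step_function]]
      LINT_step_embed_mult[OF assms(1) L2_imp_integrable[OF assms(2)]] L2_norm_step_embed[OF assms(1)]
    by (simp add: mult.commute)
  moreover have "(\<Sum>i=1..n. (u i - observation f \<xi> i n \<omega>)\<^sup>2) = ?Q - 2 * ?S - 2 * ?N + ?Y"
    by (simp add: power2_diff observation_def sum.distrib sum_subtractf sum_distrib_left algebra_simps)
  ultimately show ?thesis
    by (simp add: H_fin_def diff_divide_distrib add_divide_distrib)
qed

text \<open>A change of \<open>u\<close> between \<open>i\<close> and \<open>i + 1\<close> becomes a
  break point at \<open>i / n\<close>. The number of break points equals the number of changes, so
  the discrete penalty can be read off from the pattern.\<close>

lemma step_embed_step_pattern:
  fixes u :: "nat \<Rightarrow> real"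
  assumes "n \<ge> 1"
  defines "J \<equiv> {i. 1 \<le> i \<and> i \<le> n - 1 \<and> u i \<noteq> u (i + 1)}"
  obtains t C where "\<And>j. t j \<in> {0..1}" "step_embed n u = step_pattern (card J) t C"
proof -
  have finJ: "finite J" by (rule finite_subset[of _ "{..n}"]) (auto simp: J_def)
  obtain e where e: "bij_betw e {..<card J} J"
    using ex_bij_betw_nat_finite[OF finJ] by (auto simp: atLeast0LessThan)
  \<comment> \<open>Surplus indices get the default 1, which lies in the required range; only the
    first \<open>card J\<close> enter the pattern.\<close>
  define t where "t j = (if j < card J then real (e j) / real n else 1)" for j
  \<comment> \<open>\<open>A i\<close> collects the changes to the left of cell \<open>i\<close> and
    so identifies the constancy block of \<open>i\<close>. \<open>C\<close> reads \<open>u\<close>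
    at an arbitrary index of that block, and \<open>mono\<close> shows that the choice does not
    matter.\<close>
  define A where "A i = {j \<in> {..<card J}. e j \<le> i - 1}" for i
  define C where "C S = u (SOME i. i \<in> {1..n} \<and> A i = S)" for S
  have eJ: "e j \<in> J" if "j < card J" for j using e that by (auto simp: bij_betw_def)
  have mono: "u p = u q" if "p \<in> {1..n}" "q \<in> {1..n}" "A p = A q" "p \<le> q" for p q
  proof -
    have "u p = u (p + d)" if "p + d \<le> q" for d
      using that
    proof (induction d)
      case (Suc d)
      have "p + d \<notin> J"
      proof
        assume "p + d \<in> J"
        then have "p + d \<in> e ` {..<card J}" using e by (simp add: bij_betw_def)
        then obtain j where "j < card J" "e j = p + d" by auto
        then have "j \<in> A q" "j \<notin> A p" using Suc.prems \<open>p \<in> {1..n}\<close> by (auto simp: A_def)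
        then show False using \<open>A p = A q\<close> by simp
      qed
      then have "u (p + d) = u (p + d + 1)"
        using Suc.prems \<open>p \<in> {1..n}\<close> \<open>q \<in> {1..n}\<close> by (auto simp: J_def)
      then show ?case using Suc by simp
    qed simp
    from this[of "q - p"] show ?thesis using that by simp
  qed
  have C: "C (A i) = u i" if i: "i \<in> {1..n}" for i
  proof -
    define p where "p = (SOME p. p \<in> {1..n} \<and> A p = A i)"
    have p: "p \<in> {1..n}" "A p = A i"
      using someI[of "\<lambda>p. p \<in> {1..n} \<and> A p = A i" i] i unfolding p_def by blast+
    have "u p = u i"
    proof (cases "p \<le> i")
      case True
      then show ?thesis using mono[OF p(1) i p(2)] by blast
    next
      case False
      then show ?thesis using mono[OF i p(1)] p(2) by simp
    qed
    then show ?thesis unfolding C_def p_def .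
  qed
  have "step_embed n u x = step_pattern (card J) t C x" for x
  proof (cases "x \<in> {0..<1}")
    case True
    then obtain i where i: "i \<in> {1..n}" "x \<in> {(real i - 1) / real n..<real i / real n}"
      using grid_index assms by blast
    have "t j \<le> x \<longleftrightarrow> e j \<le> i - 1" if "j < card J" for j
    proof -
      have "real (e j) \<le> x * real n \<longleftrightarrow> e j \<le> i - 1"
      proof
        assume "real (e j) \<le> x * real n"
        also have "x * real n < real i" using i assms by (simp add: field_simps)
        finally show "e j \<le> i - 1" by simp
      next
        assume "e j \<le> i - 1"
        then have "e j + 1 \<le> i" using i(1) by auto
        then have "real (e j) \<le> real i - 1" by linarith
        also have "\<dots> \<le> x * real n" using i assms by (simp add: field_simps)
        finally show "real (e j) \<le> x * real n" .
      qed
      then show ?thesis using that assms by (simp add: t_def field_simps)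
    qed
    then have "{j \<in> {..<card J}. t j \<le> x} = A i" by (auto simp: A_def)
    then show ?thesis using True i C by (simp add: step_pattern_def step_embed_eq)
  next
    case False
    then show ?thesis using step_embed_outside[OF False] unfolding step_pattern_def by (simp only: if_False)
  qed
  moreover have "t j \<in> {0..1}" for j
  proof (cases "j < card J")
    case True
    then have "e j \<le> n" using eJ[of j] by (auto simp: J_def)
    then show ?thesis using True assms(1) by (simp add: t_def)
  qed (simp add: t_def)
  ultimately show ?thesis using that by blast
qed

text \<open>Induction that splits off the last constancy block. On a block the weighted noise is the
  common value times a block sum, which \<open>blk\<close> controls by the length. The number of
  changes plus 1 counts the blocks and is the factor that Cauchy-Schwarz across blocks
  produces.\<close>

lemma noise_bound:
  fixes \<xi> u :: "nat \<Rightarrow> real"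
  assumes blk: "\<And>i j. 1 \<le> i \<Longrightarrow> i \<le> j \<Longrightarrow> j \<le> n \<Longrightarrow> (\<Sum>k=i..j. \<xi> k)\<^sup>2 \<le> \<beta> * real (j - i + 1)"
  shows "(\<Sum>i=1..n. u i * \<xi> i)\<^sup>2 \<le>
    \<beta> * (real (card {i. 1 \<le> i \<and> i \<le> n - 1 \<and> u i \<noteq> u (i + 1)}) + 1) * (\<Sum>i=1..n. (u i)\<^sup>2)"
  using assms
proof (induction n rule: less_induct)
  case (less n)
  let ?J = "\<lambda>n. {i. 1 \<le> i \<and> i \<le> n - 1 \<and> u i \<noteq> u (i + 1)}"
  show ?case
  proof (cases "n = 0")
    case False
    \<comment> \<open>The first index of the last constancy block; its minimality yields the change
      at \<open>i - 1\<close> below.\<close>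
    define i where "i = (LEAST i. 1 \<le> i \<and> i \<le> n \<and> (\<forall>k\<in>{i..n}. u k = u n))"
    have "1 \<le> i \<and> i \<le> n \<and> (\<forall>k\<in>{i..n}. u k = u n)"
      unfolding i_def by (rule LeastI[of _ n]) (use False in auto)
    then have i: "1 \<le> i" "i \<le> n" and const: "\<And>k. k \<in> {i..n} \<Longrightarrow> u k = u n"
      by blast+
    have eq: "sum g {1..n} = sum g {1..i-1} + sum g {i..n}" for g :: "nat \<Rightarrow> real"
    proof -
      have "{1..n} = {1..i-1} \<union> {i..n}" "{1..i-1} \<inter> {i..n} = {}" using i by auto
      then show ?thesis using sum.union_disjoint[of "{1..i-1}" "{i..n}" g] by simp
    qed
    define a where "a = (\<Sum>k=1..i-1. u k * \<xi> k)"
    define b where "b = u n * (\<Sum>k=i..n. \<xi> k)"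
    define A where "A = (\<Sum>k=1..i-1. (u k)\<^sup>2)"
    define B where "B = (u n)\<^sup>2 * real (n - i + 1)"
    define k where "k = real (card (?J n))"
    note block_defs = a_def b_def A_def B_def k_def
    have S: "(\<Sum>i=1..n. u i * \<xi> i) = a + b"
    proof -
      have "(\<Sum>k=i..n. u k * \<xi> k) = b"
        unfolding block_defs sum_distrib_left
        by (rule sum.cong[OF refl], drule const, simp only:)
      then show ?thesis unfolding eq block_defs by simp
    qed
    have Q: "(\<Sum>i=1..n. (u i)\<^sup>2) = A + B"
    proof -
      have "(\<Sum>k=i..n. (u k)\<^sup>2) = (\<Sum>k=i..n. (u n)\<^sup>2)"
        by (rule sum.cong[OF refl], drule const, simp only:)
      also have "\<dots> = B"
        using i by (simp add: block_defs Suc_diff_le mult_ac)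
      finally show ?thesis unfolding eq block_defs by simp
    qed
    have "b\<^sup>2 = (u n)\<^sup>2 * (\<Sum>k=i..n. \<xi> k)\<^sup>2" by (simp add: block_defs power_mult_distrib)
    also have "\<dots> \<le> (u n)\<^sup>2 * (\<beta> * real (n - i + 1))"
      using i by (intro mult_left_mono less.prems) auto
    finally have b: "b\<^sup>2 \<le> \<beta> * B" by (simp add: block_defs mult_ac)
    have \<beta>: "0 \<le> \<beta>" using less.prems[of 1 1] False order_trans[OF zero_le_power2[of "\<xi> 1"], of \<beta>] by simp
    have A0: "A \<ge> 0" "B \<ge> 0" "k \<ge> 0" by (simp_all add: block_defs sum_nonneg)
    have "(a + b)\<^sup>2 \<le> \<beta> * (k + 1) * (A + B)"
    proof (cases "i = 1")
      case True
      then have "a = 0" "A = 0" by (simp_all add: block_defs)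
      moreover have "\<beta> * B \<le> \<beta> * B * (k + 1)" using A0 \<beta> by (simp add: algebra_simps)
      ultimately show ?thesis using b by (simp add: mult_ac)
    next
      case i1: False
      have jump: "u (i - 1) \<noteq> u (i - 1 + 1)"
      proof
        assume "u (i - 1) = u (i - 1 + 1)"
        moreover have "k = i - 1 \<or> k \<in> {i..n}" if "k \<in> {i-1..n}" for k
          using that by auto
        ultimately have "\<forall>k\<in>{i-1..n}. u k = u n"
          using const i by (metis atLeastAtMost_iff le_add_diff_inverse2 order_refl)
        moreover have "1 \<le> i - 1" "i - 1 \<le> n" using i i1 by linarith+
        ultimately have "i \<le> i - 1"
          using Least_le[of "\<lambda>i. 1 \<le> i \<and> i \<le> n \<and> (\<forall>k\<in>{i..n}. u k = u n)" "i - 1"]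
          unfolding i_def[symmetric] by blast
        then show False using i by simp
      qed
      \<comment> \<open>The prefix up to \<open>i - 1\<close> loses exactly one change, the one at
        the boundary, since none occurs inside the last block.\<close>
      have "?J n = insert (i - 1) (?J (i - 1))"
      proof (intro set_eqI)
        fix j
        have "u j = u (j + 1)" if "i \<le> j" "j \<le> n - 1" "1 \<le> j"
        proof -
          have "j \<in> {i..n}" "j + 1 \<in> {i..n}" using that i by auto
          then show ?thesis using const by metis
        qed
        then have above: "j \<notin> ?J n" "j \<notin> ?J (i - 1)" if "i \<le> j"
          using that i by (blast, auto)
        have "1 \<le> i - 1" "i - 1 \<le> n - 1" using i i1 by linarith+
        then have at: "i - 1 \<in> ?J n" using jump by blast
        have below: "j \<in> ?J n \<longleftrightarrow> j \<in> ?J (i - 1)" if "j < i - 1" using that i by auto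
        consider "j < i - 1" | "j = i - 1" | "i \<le> j" "j \<noteq> i - 1" using i i1 by linarith
        then show "j \<in> ?J n \<longleftrightarrow> j \<in> insert (i - 1) (?J (i - 1))"
        proof cases
          case 1
          then have "j \<noteq> i - 1" by simp
          then show ?thesis using below[OF 1] by (simp only: insert_iff simp_thms)
        next
          case 2
          then show ?thesis using at by (simp only: insert_iff simp_thms)
        next
          case 3
          then show ?thesis using above[OF 3(1)] by (simp only: insert_iff simp_thms)
        qed
      qed
      moreover have "finite (?J (i - 1))" by (rule finite_subset[of _ "{..i}"]) auto
      moreover have "i - 1 \<notin> ?J (i - 1)" using i i1 by auto
      ultimately have k: "k = real (card (?J (i - 1))) + 1" by (simp add: block_defs)
      have "a\<^sup>2 \<le> \<beta> * k * A"
        unfolding k block_defs using i False by (intro less.IH less.prems) auto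
      have k1: "k \<ge> 1" using k by simp
      \<comment> \<open>Cauchy-Schwarz for the last block against the \<open>k\<close> earlier ones:
        the difference of the two sides in the next line is exactly this square.\<close>
      have "0 \<le> (a - k * b)\<^sup>2" by simp
      then have "k * (a + b)\<^sup>2 \<le> (k + 1) * (a\<^sup>2 + k * b\<^sup>2)"
        by (simp add: power2_eq_square algebra_simps)
      also have "\<dots> \<le> (k + 1) * (\<beta> * k * A + k * (\<beta> * B))"
        using \<open>a\<^sup>2 \<le> \<beta> * k * A\<close> b k1 by (intro mult_left_mono add_mono) auto
      also have "\<dots> = k * (\<beta> * (k + 1) * (A + B))" by (simp add: algebra_simps)
      finally show ?thesis using k1 by simp
    qed
    then show ?thesis unfolding S Q block_defs .
  qed simp
qed

section \<open>The limit functional and its unique minimizer\<close>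

lemma H_inf_step:
  assumes "h \<in> step_functions" "L2_eq g h"
  shows "H_inf \<gamma> g f = ereal (\<gamma> * real (card (jumps h)) + (L2_norm (\<lambda>x. f x - g x))\<^sup>2)"
  using assms step_rep_eq[OF assms] by (auto simp: H_inf_def is_step_class_def)

lemma L2_eq_refl: "L2_eq g g"
  by (simp add: L2_eq_def)

text \<open>Translates minimality over classes, with extended real values, into real inequalities
  between genuine step functions; \<open>s\<close> is obtained as the step function representing the
  class of \<open>g\<close>.\<close>

lemma unique_minimizerE:
  assumes um: "unique_minimizer \<gamma> f g" and f: "f \<in> L2"
  obtains s where "s \<in> step_functions" "g \<in> L2"
    "\<And>h. h \<in> step_functions \<Longrightarrow> \<gamma> * real (card (jumps s)) + (L2_norm (\<lambda>x. f x - s x))\<^sup>2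
        \<le> \<gamma> * real (card (jumps h)) + (L2_norm (\<lambda>x. f x - h x))\<^sup>2"
    "\<And>h. h \<in> step_functions \<Longrightarrow> \<gamma> * real (card (jumps h)) + (L2_norm (\<lambda>x. f x - h x))\<^sup>2
        \<le> \<gamma> * real (card (jumps s)) + (L2_norm (\<lambda>x. f x - s x))\<^sup>2 \<Longrightarrow> L2_eq h g"
proof -
  have am: "is_arg_min (\<lambda>h. H_inf \<gamma> h f) (\<lambda>h. h \<in> L2) g"
    using um unfolding unique_minimizer_def by (rule conjunct1)
  have g: "g \<in> L2"
    using am unfolding is_arg_min_def by (rule conjunct1)
  have le: "H_inf \<gamma> g f \<le> H_inf \<gamma> h f" if "h \<in> L2" for h
    using am that unfolding is_arg_min_def by (meson not_less)
  have uniq: "L2_eq h g" if "h \<in> L2" "H_inf \<gamma> h f \<le> H_inf \<gamma> g f" for h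
  proof -
    have "is_arg_min (\<lambda>h. H_inf \<gamma> h f) (\<lambda>h. h \<in> L2) h"
      unfolding is_arg_min_def using that le by (meson leD le_less_trans)
    then show ?thesis using um unfolding unique_minimizer_def by blast
  qed
  \<comment> \<open>The zero function has finite energy, so the minimizer is the class of a step
    function.\<close>
  have "H_inf \<gamma> g f \<noteq> \<infinity>"
    using le[OF step_function_L2[OF step_pattern_step_function[of 0 "\<lambda>_. 0" "\<lambda>_. 0"]]]
      H_inf_step[OF step_pattern_step_function L2_eq_refl, of \<gamma> 0 "\<lambda>_. 0" "\<lambda>_. 0" f] by auto
  then have "is_step_class g" by (auto simp: H_inf_def split: if_splits)
  then obtain s where s: "s \<in> step_functions" "L2_eq g s"
    by (auto simp: is_step_class_def)
  have "L2_norm (\<lambda>x. f x - g x) = L2_norm (\<lambda>x. f x - s x)"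
  proof (rule L2_norm_AE_cong)
    show "AE x in unit_ivl. f x - g x = f x - s x"
      using s(2) unfolding L2_eq_def by eventually_elim simp
  qed (use L2_diff[OF f g] L2_diff[OF f step_function_L2[OF s(1)]] in \<open>auto simp: L2_def\<close>)
  then have Hg: "H_inf \<gamma> g f = ereal (\<gamma> * real (card (jumps s)) + (L2_norm (\<lambda>x. f x - s x))\<^sup>2)"
    using H_inf_step[OF s] by simp
  have Hh: "H_inf \<gamma> h f = ereal (\<gamma> * real (card (jumps h)) + (L2_norm (\<lambda>x. f x - h x))\<^sup>2)"
    if "h \<in> step_functions" for h
    using H_inf_step[OF that L2_eq_refl] .
  show ?thesis
  proof (rule that[OF s(1) g])
    fix h assume h: "h \<in> step_functions"
    show "\<gamma> * real (card (jumps s)) + (L2_norm (\<lambda>x. f x - s x))\<^sup>2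
        \<le> \<gamma> * real (card (jumps h)) + (L2_norm (\<lambda>x. f x - h x))\<^sup>2"
      using le[OF step_function_L2[OF h]] unfolding Hg Hh[OF h] by simp
    show "L2_eq h g" if "\<gamma> * real (card (jumps h)) + (L2_norm (\<lambda>x. f x - h x))\<^sup>2
        \<le> \<gamma> * real (card (jumps s)) + (L2_norm (\<lambda>x. f x - s x))\<^sup>2"
      using that by (intro uniq step_function_L2 h) (simp add: Hg Hh[OF h])
  qed
qed

section \<open>Grid samples as competitors\<close>

abbreviation change_count :: "nat \<Rightarrow> (nat \<Rightarrow> real) \<Rightarrow> nat" where
  "change_count n u \<equiv> card {i. 1 \<le> i \<and> i \<le> n - 1 \<and> u i \<noteq> u (i + 1)}"

text \<open>Point values rather than cell averages: averaging over a cell that contains a jump can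
  turn one jump into two changes. \<open>restrict\<close> makes the sample an admissible vector of
  the extensional space.\<close>

definition grid_sample :: "(real \<Rightarrow> real) \<Rightarrow> nat \<Rightarrow> nat \<Rightarrow> real" where
  "grid_sample g n = restrict (\<lambda>i. g ((real i - 1) / real n)) {1..n}"

text \<open>Each change at \<open>i\<close> picks a jump in the half-open interval from
  \<open>(i - 1) / n\<close> to \<open>i / n\<close>; these intervals are disjoint, so the choice is
  injective.\<close>

lemma grid_sample_changes:
  assumes g: "g \<in> step_functions"
  shows "change_count n (grid_sample g n) \<le> card (jumps g)"
proof -
  let ?J = "{i. 1 \<le> i \<and> i \<le> n - 1 \<and> grid_sample g n i \<noteq> grid_sample g n (i + 1)}"
  have "\<forall>i\<in>?J. \<exists>t. t \<in> jumps g \<and> (real i - 1) / real n < t \<and> t \<le> real i / real n"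
  proof (rule ballI, rule jump_between[OF g, unfolded Bex_def])
    fix i assume i: "i \<in> ?J"
    have "1 \<le> real i" "real i < real n" using i by auto
    then show "0 \<le> (real i - 1) / real n" "(real i - 1) / real n \<le> real i / real n" "real i / real n < 1"
      by (auto intro: divide_right_mono)
    have "i \<in> {1..n}" "i + 1 \<in> {1..n}" "real (i + 1) - 1 = real i" using i by auto
    then show "g ((real i - 1) / real n) \<noteq> g (real i / real n)"
      using i by (simp add: grid_sample_def)
  qed
  from bchoice[OF this] obtain \<tau> where
    \<tau>: "\<forall>i\<in>?J. \<tau> i \<in> jumps g \<and> (real i - 1) / real n < \<tau> i \<and> \<tau> i \<le> real i / real n" ..
  have "inj_on \<tau> ?J"
  proof (rule inj_onI)
    fix i j assume ij: "i \<in> ?J" "j \<in> ?J" "\<tau> i = \<tau> j"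
    then have "n > 0" by auto
    have "(real i - 1) / real n < real j / real n" "(real j - 1) / real n < real i / real n"
      using bspec[OF \<tau> ij(1)] bspec[OF \<tau> ij(2)] ij(3) by linarith+
    then have "real i - 1 < real j" "real j - 1 < real i"
      using \<open>n > 0\<close> by (simp_all add: divide_less_cancel)
    then show "i = j" by linarith
  qed
  moreover have "\<tau> ` ?J \<subseteq> jumps g" using \<tau> by blast
  ultimately show ?thesis by (rule card_inj_on_le) (rule finite_jumps[OF g])
qed

lemma grid_sample_bound:
  assumes "\<And>x. \<bar>g x\<bar> \<le> B"
  shows "\<bar>step_embed n (grid_sample g n) x\<bar> \<le> B"
proof (cases "n \<ge> 1 \<and> x \<in> {0..<1}")
  case True
  then obtain i where i: "i \<in> {1..n}" "x \<in> {(real i - 1) / real n..<real i / real n}"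
    using grid_index by blast
  then show ?thesis using assms by (simp add: step_embed_eq[OF i] grid_sample_def)
next
  case False
  then have "step_embed n (grid_sample g n) x = 0"
  proof (cases "n = 0")
    case True
    then show ?thesis by (simp add: step_embed_def)
  next
    case False
    then have "x \<notin> {0..<1}" using \<open>\<not> (n \<ge> 1 \<and> x \<in> {0..<1})\<close> by linarith
    then show ?thesis by (rule step_embed_outside)
  qed
  moreover have "0 \<le> B" using assms[of x] by linarith
  ultimately show ?thesis by simp
qed

lemma grid_sample_tendsto:
  assumes x: "x \<in> {0..<1}" and const: "\<forall>\<^sub>F y in at x. g y = g x"
  shows "(\<lambda>n. step_embed n (grid_sample g n) x) \<longlonglongrightarrow> g x"
proof (rule tendsto_eventually)
  obtain d where d: "d > 0" "\<And>y. \<bar>y - x\<bar> < d \<Longrightarrow> g y = g x"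
    using const unfolding eventually_at dist_real_def by (metis UNIV_I)
  show "\<forall>\<^sub>F n in sequentially. step_embed n (grid_sample g n) x = g x"
    using eventually_gt_at_top[of "nat \<lceil>1 / d\<rceil>"]
  proof eventually_elim
    case (elim n)
    then have "1 / d < real n" "n \<ge> 1" by linarith+
    then have nd: "1 / real n < d" using d by (simp add: field_simps)
    obtain i where i: "i \<in> {1..n}" "x \<in> {(real i - 1) / real n..<real i / real n}"
      using grid_index[OF \<open>n \<ge> 1\<close> x] by blast
    have "real i / real n = (real i - 1) / real n + 1 / real n" by (simp add: diff_divide_distrib)
    then have "\<bar>(real i - 1) / real n - x\<bar> < d" using i(2) nd by auto
    then have "g ((real i - 1) / real n) = g x" by (rule d(2))
    then show ?case using i(1) by (simp add: step_embed_eq[OF i] grid_sample_def)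
  qed
qed

text \<open>Dominated convergence, using that \<open>g\<close> is locally constant off a finite set.
  Together with \<open>grid_sample_changes\<close> it makes the samples a recovery sequence for
  \<open>g\<close>.\<close>

lemma grid_sample_L2_tendsto:
  assumes g: "g \<in> step_functions" and f: "f \<in> L2"
  shows "(\<lambda>n. (L2_norm (\<lambda>x. f x - step_embed n (grid_sample g n) x))\<^sup>2) \<longlonglongrightarrow> (L2_norm (\<lambda>x. f x - g x))\<^sup>2"
proof -
  obtain B where B: "\<And>x. \<bar>g x\<bar> \<le> B" using step_function_bounded[OF g] by blast
  obtain D where D: "finite D" "\<And>x. x \<notin> D \<Longrightarrow> \<forall>\<^sub>F y in at x. g y = g x"
    using step_function_locally_constant_off_finite[OF g] by blast
  have fm: "f \<in> borel_measurable unit_ivl" and fi: "integrable unit_ivl (\<lambda>x. (f x)\<^sup>2)"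
    using f by (auto simp: L2_def)
  show ?thesis
    unfolding L2_norm_power2
  proof (rule integral_dominated_convergence[where w = "\<lambda>x. 2 * (f x)\<^sup>2 + 2 * B\<^sup>2"])
    show "(\<lambda>x. (f x - g x)\<^sup>2) \<in> borel_measurable unit_ivl"
      using fm borel_unit_ivl[OF borel_measurable_step_function[OF g]] by measurable
    show "(\<lambda>x. (f x - step_embed n (grid_sample g n) x)\<^sup>2) \<in> borel_measurable unit_ivl" for n
      using fm borel_unit_ivl[OF borel_measurable_step_function[OF step_embed_step_function[of n "grid_sample g n"]]]
      by measurable
    show "integrable unit_ivl (\<lambda>x. 2 * (f x)\<^sup>2 + 2 * B\<^sup>2)"
      using fi integrable_unit_ivl_bounded[of "\<lambda>_. 2 * B\<^sup>2" "2 * B\<^sup>2"] by simp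
    have "AE x in unit_ivl. x \<in> {0..<1}" by (rule AE_I2) simp
    with AE_unit_ivl_not_finite[OF D(1)]
    show "AE x in unit_ivl. (\<lambda>n. (f x - step_embed n (grid_sample g n) x)\<^sup>2) \<longlonglongrightarrow> (f x - g x)\<^sup>2"
    proof eventually_elim
      case (elim x)
      then show ?case by (intro tendsto_intros grid_sample_tendsto D(2))
    qed
    show "AE x in unit_ivl. norm ((f x - step_embed n (grid_sample g n) x)\<^sup>2) \<le> 2 * (f x)\<^sup>2 + 2 * B\<^sup>2" for n
    proof (rule AE_I2)
      fix x
      let ?v = "step_embed n (grid_sample g n) x"
      have "?v\<^sup>2 \<le> B\<^sup>2"
        using power_mono[OF grid_sample_bound[of g B n x, OF B], of 2] by simp
      moreover have "(f x - ?v)\<^sup>2 \<le> 2 * (f x)\<^sup>2 + 2 * ?v\<^sup>2"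
        using zero_le_power2[of "f x + ?v"] by (simp add: power2_eq_square algebra_simps)
      ultimately show "norm ((f x - ?v)\<^sup>2) \<le> 2 * (f x)\<^sup>2 + 2 * B\<^sup>2" by simp
    qed
  qed
qed

section \<open>Convergence of the penalized estimates\<close>

lemma scaled_noise_bound:
  fixes \<xi> u :: "nat \<Rightarrow> real"
  assumes n: "n \<ge> 1"
    and blk: "\<And>i j. 1 \<le> i \<Longrightarrow> i \<le> j \<Longrightarrow> j \<le> n \<Longrightarrow> (\<Sum>k=i..j. \<xi> k)\<^sup>2 \<le> \<beta> * real (j - i + 1)"
  shows "\<bar>2 / real n * (\<Sum>i=1..n. u i * \<xi> i)\<bar> \<le>
    sqrt (\<beta> / real n) * (real (change_count n u) + 1 + (L2_norm (step_embed n u))\<^sup>2)"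
proof -
  define N where "N = (\<Sum>i=1..n. u i * \<xi> i)"
  define Q where "Q = (\<Sum>i=1..n. (u i)\<^sup>2)"
  define k where "k = real (change_count n u) + 1"
  have W: "(L2_norm (step_embed n u))\<^sup>2 = Q / real n"
    using L2_norm_step_embed[OF n] by (simp add: Q_def)
  have \<beta>: "0 \<le> \<beta>" using blk[of 1 1] n order_trans[OF zero_le_power2[of "\<xi> 1"], of \<beta>] by simp
  have Q0: "0 \<le> Q" by (simp add: Q_def sum_nonneg)
  have "N\<^sup>2 \<le> \<beta> * k * Q"
    unfolding N_def Q_def k_def by (rule noise_bound[OF blk])
  then have "4 * N\<^sup>2 / (real n)\<^sup>2 \<le> 4 * (\<beta> * k * Q) / (real n)\<^sup>2"
    by (intro divide_right_mono) auto
  moreover have "(2 / real n * N)\<^sup>2 = 4 * N\<^sup>2 / (real n)\<^sup>2"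
    by (simp add: power_mult_distrib power_divide)
  moreover have "4 * (\<beta> * k * Q) / (real n)\<^sup>2 = \<beta> / real n * (4 * (k * (Q / real n)))"
    using n by (simp add: power2_eq_square)
  \<comment> \<open>The arithmetic-geometric mean inequality separates the number of blocks from the
    norm. The resulting sum can be absorbed by penalty and fit once \<open>\<beta> / n\<close> is
    small.\<close>
  moreover have "4 * (a * b) \<le> (a + b)\<^sup>2" for a b :: real
    using zero_le_power2[of "a - b"] by (simp add: power2_eq_square algebra_simps)
  then have "\<beta> / real n * (4 * (k * (Q / real n))) \<le> \<beta> / real n * (k + Q / real n)\<^sup>2"
    by (rule mult_left_mono) (use \<beta> in simp)
  moreover have "\<beta> / real n * (k + Q / real n)\<^sup>2 = (sqrt (\<beta> / real n) * (k + Q / real n))\<^sup>2"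
    using \<beta> by (simp add: power_mult_distrib)
  ultimately have "\<bar>2 / real n * N\<bar>\<^sup>2 \<le> (sqrt (\<beta> / real n) * (k + Q / real n))\<^sup>2"
    unfolding power2_abs by linarith
  then have "\<bar>2 / real n * N\<bar> \<le> sqrt (\<beta> / real n) * (k + Q / real n)"
    by (rule power2_le_imp_le) (use \<beta> Q0 in \<open>auto simp: k_def intro!: mult_nonneg_nonneg add_nonneg_nonneg\<close>)
  then show ?thesis unfolding N_def W k_def .
qed

text \<open>The deterministic core, for one fixed outcome: \<open>E\<close> is the objective without
  the terms that do not depend on the vector.\<close>

lemma penalized_estimates_converge:
  fixes f g :: "real \<Rightarrow> real" and \<xi> u :: "nat \<Rightarrow> nat \<Rightarrow> real" and \<gamma>n :: "nat \<Rightarrow> real"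
  defines "E \<equiv> \<lambda>n v. \<gamma>n n * real (change_count n v) + (L2_norm (\<lambda>x. f x - step_embed n v x))\<^sup>2
      - 2 / real n * (\<Sum>i=1..n. v i * \<xi> n i)"
  assumes f: "f \<in> L2" and \<gamma>: "\<gamma> > 0" and um: "unique_minimizer \<gamma> f g"
    and \<gamma>n: "\<gamma>n \<longlonglongrightarrow> \<gamma>"
    and \<beta>: "(\<lambda>n. \<beta> n / real n) \<longlonglongrightarrow> 0"
    and blk: "\<forall>\<^sub>F n in sequentially. \<forall>i j. 1 \<le> i \<longrightarrow> i \<le> j \<longrightarrow> j \<le> n \<longrightarrow>
      (\<Sum>k=i..j. \<xi> n k)\<^sup>2 \<le> \<beta> n * real (j - i + 1)"
    and opt: "\<And>n v. n \<ge> 1 \<Longrightarrow> v \<in> {1..n} \<rightarrow>\<^sub>E UNIV \<Longrightarrow> E n (u n) \<le> E n v"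
  shows "(\<lambda>n. L2_norm (\<lambda>x. step_embed n (u n) x - g x)) \<longlonglongrightarrow> 0"
proof -
  obtain s where s: "s \<in> step_functions" and g: "g \<in> L2"
    and smin: "\<And>h. h \<in> step_functions \<Longrightarrow> \<gamma> * real (card (jumps s)) + (L2_norm (\<lambda>x. f x - s x))\<^sup>2
        \<le> \<gamma> * real (card (jumps h)) + (L2_norm (\<lambda>x. f x - h x))\<^sup>2"
    and suniq: "\<And>h. h \<in> step_functions \<Longrightarrow> \<gamma> * real (card (jumps h)) + (L2_norm (\<lambda>x. f x - h x))\<^sup>2
        \<le> \<gamma> * real (card (jumps s)) + (L2_norm (\<lambda>x. f x - s x))\<^sup>2 \<Longrightarrow> L2_eq h g"
    using unique_minimizerE[OF um f] by blast
  obtain B where B: "\<And>x. \<bar>s x\<bar> \<le> B" using step_function_bounded[OF s] by blast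
  define m where "m = \<gamma> * real (card (jumps s)) + (L2_norm (\<lambda>x. f x - s x))\<^sup>2"
  define k where "k n = change_count n (u n)" for n
  define W where "W n = (L2_norm (step_embed n (u n)))\<^sup>2" for n
  define F where "F n = (L2_norm (\<lambda>x. f x - step_embed n (u n) x))\<^sup>2" for n
  define a where "a = (L2_norm f)\<^sup>2"
  define \<delta> where "\<delta> n = sqrt (\<beta> n / real n)" for n
  define p where "p = real (card (jumps s))"
  define v where "v n = grid_sample s n" for n
  define G where "G n = (L2_norm (\<lambda>x. f x - step_embed n (v n) x))\<^sup>2" for n
  \<comment> \<open>\<open>K\<close> and \<open>R\<close> are read off from
    \<open>\<gamma> / 4 * k + 3 / 8 * W \<le> 2 * a + \<gamma> / 2\<close>, which comes from
    comparing with the zero vector.\<close>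
  define K where "K = (8 * a + 2 * \<gamma>) / \<gamma>"
  define R where "R = 8 / 3 * (2 * a + \<gamma> / 2)"
  have \<delta>0: "\<delta> \<longlonglongrightarrow> 0" unfolding \<delta>_def using tendsto_real_sqrt[OF \<beta>] by simp
  have "\<exists>t C. (\<forall>j. t j \<in> {0..1}) \<and> step_embed n (u n) = step_pattern (k n) t C" for n
  proof (cases "n \<ge> 1")
    case True
    obtain t C where "\<And>j. t j \<in> {0..1}" "step_embed n (u n) = step_pattern (change_count n (u n)) t C"
      by (rule step_embed_step_pattern[OF True, of "u n"]) blast
    then show ?thesis unfolding k_def by blast
  next
    \<comment> \<open>For \<open>n = 0\<close> the embedding is the zero function; it gets a pattern
      too because \<open>minimizing_sequence_converges\<close> speaks of all
      \<open>n\<close>.\<close>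
    case False
    then have "step_embed n (u n) = step_pattern (k n) (\<lambda>_. 0) (\<lambda>_. 0)"
      by (auto simp: step_embed_def step_pattern_def not_le)
    then show ?thesis by (intro exI[of _ "\<lambda>_. 0"]) auto
  qed
  then obtain t C where t: "\<And>n j. t n j \<in> {0..1}" and tC: "\<And>n. step_embed n (u n) = step_pattern (k n) (t n) (C n)"
    by metis
  have WF: "W n \<le> 2 * F n + 2 * a" for n
    unfolding W_def F_def a_def by (rule L2_norm_sq_triangle[OF step_function_L2[OF step_embed_step_function] f])
  have cmp: "\<gamma>n n * real (k n) + F n \<le> \<gamma>n n * real (change_count n w) + (L2_norm (\<lambda>x. f x - step_embed n w x))\<^sup>2
      + \<delta> n * (real (k n) + 1 + W n) + \<delta> n * (real (change_count n w) + 1 + (L2_norm (step_embed n w))\<^sup>2)"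
    if "n \<ge> 1" "w \<in> {1..n} \<rightarrow>\<^sub>E UNIV" and b: "\<forall>i j. 1 \<le> i \<longrightarrow> i \<le> j \<longrightarrow> j \<le> n \<longrightarrow>
      (\<Sum>k=i..j. \<xi> n k)\<^sup>2 \<le> \<beta> n * real (j - i + 1)" for n w
  proof -
    have "\<bar>2 / real n * (\<Sum>i=1..n. x i * \<xi> n i)\<bar> \<le>
      \<delta> n * (real (change_count n x) + 1 + (L2_norm (step_embed n x))\<^sup>2)" for x
      unfolding \<delta>_def by (rule scaled_noise_bound[OF \<open>n \<ge> 1\<close>]) (use b in blast)
    from this[of w] this[of "u n"] opt[OF that(1,2)] show ?thesis
      unfolding E_def k_def F_def W_def by linarith
  qed
  \<comment> \<open>With \<open>\<delta> n\<close> below \<open>\<gamma> / 4\<close> and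
    \<open>1 / 8\<close>, the noise uses up half of the penalty weight \<open>\<gamma> / 2\<close>
    and a quarter of the \<open>W / 2\<close> supplied by \<open>WF\<close>; what remains is
    \<open>\<gamma> / 4\<close> and \<open>3 / 8\<close>.\<close>
  have bounds: "\<forall>\<^sub>F n in sequentially. real (k n) \<le> K \<and> W n \<le> R"
  proof -
    have "\<forall>\<^sub>F n in sequentially. \<delta> n < min (\<gamma> / 4) (1 / 8)"
      by (rule order_tendstoD(2)[OF \<delta>0]) (use \<gamma> in simp)
    moreover have "\<forall>\<^sub>F n in sequentially. \<gamma>n n > \<gamma> / 2"
      by (rule order_tendstoD(1)[OF \<gamma>n]) (use \<gamma> in simp)
    moreover note blk eventually_ge_at_top[of 1]
    ultimately show ?thesis
    proof eventually_elim
      case (elim n)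
      define z :: "nat \<Rightarrow> real" where "z = restrict (\<lambda>_. 0) {1..n}"
      have z: "z \<in> {1..n} \<rightarrow>\<^sub>E UNIV" by (simp add: z_def)
      have e: "{i. 1 \<le> i \<and> i \<le> n - 1 \<and> z i \<noteq> z (i + 1)} = {}" by (auto simp: z_def)
      have "step_embed n z = (\<lambda>_. 0)" by (auto simp: step_embed_def z_def)
      then have sz: "(L2_norm (step_embed n z))\<^sup>2 = 0" "(L2_norm (\<lambda>x. f x - step_embed n z x))\<^sup>2 = a"
        by (simp_all add: L2_norm_def a_def)
      \<comment> \<open>\<open>sqrt\<close> is negative on negative arguments, so the sign of
        \<open>\<beta> n\<close> is taken from the block consisting of index 1 alone.\<close>
      have \<delta>n: "0 \<le> \<delta> n"
        using elim(3)[rule_format, of 1 1] elim(4) order_trans[OF zero_le_power2[of "\<xi> n 1"], of "\<beta> n"]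
        by (simp add: \<delta>_def)
      have W0: "0 \<le> W n" by (simp add: W_def)
      have "\<gamma>n n * real (k n) + F n \<le> a + \<delta> n * (real (k n) + 1 + W n) + \<delta> n"
        using cmp[OF elim(4) z elim(3)] unfolding e sz by simp
      moreover have "\<gamma> / 2 * real (k n) \<le> \<gamma>n n * real (k n)"
        using elim by (intro mult_right_mono) auto
      moreover have "\<delta> n * (real (k n) + 1 + W n) + \<delta> n = \<delta> n * real (k n) + 2 * \<delta> n + \<delta> n * W n"
        by (simp add: algebra_simps)
      moreover have "\<delta> n * real (k n) \<le> \<gamma> / 4 * real (k n)" "\<delta> n * W n \<le> 1 / 8 * W n"
        using elim(1) W0 by (intro mult_right_mono; simp)+
      moreover have "2 * \<delta> n \<le> \<gamma> / 2" using elim by simp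
      ultimately have "\<gamma> / 4 * real (k n) + 3 / 8 * W n \<le> 2 * a + \<gamma> / 2"
        using WF[of n] by linarith
      moreover have "0 \<le> \<gamma> / 4 * real (k n)" using \<gamma> by simp
      ultimately have "3 / 8 * W n \<le> 2 * a + \<gamma> / 2" and \<gamma>k: "\<gamma> * real (k n) \<le> 8 * a + 2 * \<gamma>"
        using W0 by linarith+
      then have "W n \<le> R" by (simp add: R_def field_simps)
      moreover have "real (k n) \<le> K" using \<gamma>k \<gamma> by (simp add: K_def field_simps)
      ultimately show ?case by blast
    qed
  qed
  \<comment> \<open>Comparison with the samples of \<open>s\<close>. Replacing
    \<open>\<gamma>n n\<close> by \<open>\<gamma>\<close> costs at most
    \<open>abs (\<gamma> - \<gamma>n n) * K\<close>, and \<open>M\<close> bounds everything that is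
    multiplied by \<open>\<delta> n\<close>, so the total bound tends to \<open>m\<close>.\<close>
  have le: "\<forall>\<^sub>F n in sequentially. \<gamma> * real (k n) + F n \<le> m + e" if "e > 0" for e
  proof -
    define M where "M = K + 1 + R + (p + 1 + B\<^sup>2)"
    have "(\<lambda>n. \<bar>\<gamma> - \<gamma>n n\<bar> * K + \<bar>\<gamma>n n\<bar> * p + G n + \<delta> n * M) \<longlonglongrightarrow>
        \<bar>\<gamma> - \<gamma>\<bar> * K + \<bar>\<gamma>\<bar> * p + (L2_norm (\<lambda>x. f x - s x))\<^sup>2 + 0 * M"
      unfolding G_def v_def by (intro tendsto_intros \<gamma>n \<delta>0 grid_sample_L2_tendsto s f)
    then have "(\<lambda>n. \<bar>\<gamma> - \<gamma>n n\<bar> * K + \<bar>\<gamma>n n\<bar> * p + G n + \<delta> n * M) \<longlonglongrightarrow> m"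
      using \<gamma> by (simp add: m_def p_def)
    then have "\<forall>\<^sub>F n in sequentially. \<bar>\<gamma> - \<gamma>n n\<bar> * K + \<bar>\<gamma>n n\<bar> * p + G n + \<delta> n * M < m + e"
      by (rule order_tendstoD(2)) (use that in simp)
    with eventually_ge_at_top[of 1] blk bounds show ?thesis
    proof eventually_elim
      case (elim n)
      have \<delta>n: "0 \<le> \<delta> n"
        using elim(2)[rule_format, of 1 1] elim(1) order_trans[OF zero_le_power2[of "\<xi> n 1"], of "\<beta> n"]
        by (simp add: \<delta>_def)
      have ve: "v n \<in> {1..n} \<rightarrow>\<^sub>E UNIV" by (simp add: v_def grid_sample_def)
      have cp: "real (change_count n (v n)) \<le> p"
        unfolding p_def v_def using grid_sample_changes[OF s] by simp
      have vB: "(L2_norm (step_embed n (v n)))\<^sup>2 \<le> B\<^sup>2"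
      proof -
        have "(v n i)\<^sup>2 \<le> B\<^sup>2" if "i \<in> {1..n}" for i
          using power_mono[OF B[of "(real i - 1) / real n"], of 2] that by (simp add: v_def grid_sample_def)
        then have "(\<Sum>i=1..n. (v n i)\<^sup>2) \<le> real (card {1..n}) * B\<^sup>2"
          by (intro sum_bounded_above) auto
        then show ?thesis using elim(1) by (simp add: L2_norm_step_embed field_simps)
      qed
      have "\<delta> n * (real (k n) + 1 + W n) + \<delta> n * (real (change_count n (v n)) + 1 + (L2_norm (step_embed n (v n)))\<^sup>2) \<le> \<delta> n * M"
        unfolding M_def distrib_left[symmetric] using elim(3) cp vB \<delta>n by (intro mult_left_mono) linarith+
      moreover have "\<gamma>n n * real (change_count n (v n)) \<le> \<bar>\<gamma>n n\<bar> * p"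
        using cp by (intro mult_mono) auto
      moreover have "(\<gamma> - \<gamma>n n) * real (k n) \<le> \<bar>\<gamma> - \<gamma>n n\<bar> * K"
        using elim(3) by (intro mult_mono) auto
      ultimately show ?case
        using cmp[OF elim(1) ve elim(2)] elim(4) unfolding left_diff_distrib G_def by linarith
    qed
  qed
  show ?thesis
  proof (rule minimizing_sequence_converges[OF f g \<gamma>])
    show "m \<le> \<gamma> * real (card (jumps h)) + (L2_norm (\<lambda>x. f x - h x))\<^sup>2" if "h \<in> step_functions" for h
      unfolding m_def by (rule smin[OF that])
    show "L2_eq h g" if "h \<in> step_functions"
      "\<gamma> * real (card (jumps h)) + (L2_norm (\<lambda>x. f x - h x))\<^sup>2 \<le> m" for h
      using suniq that unfolding m_def by blast
    show "\<forall>\<^sub>F n in sequentially. \<gamma> * real (k n) + (L2_norm (\<lambda>x. f x - step_embed n (u n) x))\<^sup>2 \<le> m + e"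
      if "e > 0" for e using le[OF that] unfolding F_def .
  qed (fact t tC)+
qed

section \<open>Passing to almost every outcome\<close>

theorem theorem1:
  fixes M :: "'a measure"
    and \<xi> :: "nat \<Rightarrow> nat \<Rightarrow> 'a \<Rightarrow> real"
    and f f_\<gamma> :: "real \<Rightarrow> real"
    and \<gamma> :: real
    and \<gamma>n :: "nat \<Rightarrow> 'a \<Rightarrow> real"
    and fhat :: "nat \<Rightarrow> 'a \<Rightarrow> real \<Rightarrow> real"
  assumes "prob_space M"
    and "centered_array M \<xi>"
    and "condition_A M \<xi>"
    and "f \<in> L2"
    and "\<gamma> > 0"
    and "unique_minimizer \<gamma> f f_\<gamma>"
    and "\<And>n. n \<ge> 1 \<Longrightarrow> \<gamma>n n \<in> borel_measurable M"
    and "\<And>n \<omega>. n \<ge> 1 \<Longrightarrow> \<omega> \<in> space M \<Longrightarrow> \<gamma>n n \<omega> > 0"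
    and "AE \<omega> in M. (\<lambda>n. \<gamma>n n \<omega>) \<longlonglongrightarrow> \<gamma>"
    and "\<And>n \<omega>. n \<ge> 1 \<Longrightarrow> \<omega> \<in> space M \<Longrightarrow>
           fhat n \<omega> \<in> step_embed n ` argmin_H_fin n (\<gamma>n n \<omega>) (\<lambda>i. observation f \<xi> i n \<omega>)"
  shows "AE \<omega> in M. (\<lambda>n. L2_norm (\<lambda>x. fhat n \<omega> x - f_\<gamma> x)) \<longlonglongrightarrow> 0"
proof -
  obtain \<beta> :: "nat \<Rightarrow> real" where \<beta>: "(\<lambda>n. \<beta> n / real n) \<longlonglongrightarrow> 0"
    and max: "AE \<omega> in M. \<forall>\<^sub>F n in sequentially.
      (MAX (i, j) \<in> {(i, j). 1 \<le> i \<and> i \<le> j \<and> j \<le> n}.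
        (\<Sum>k=i..j. \<xi> k n \<omega>)\<^sup>2 / real (j - i + 1)) \<le> \<beta> n"
    using \<open>condition_A M \<xi>\<close> unfolding condition_A_def by blast
  show ?thesis
    using max \<open>AE \<omega> in M. (\<lambda>n. \<gamma>n n \<omega>) \<longlonglongrightarrow> \<gamma>\<close> AE_space
  proof eventually_elim
    case (elim \<omega>)
    have blk: "\<forall>\<^sub>F n in sequentially. \<forall>i j. 1 \<le> i \<longrightarrow> i \<le> j \<longrightarrow> j \<le> n \<longrightarrow>
      (\<Sum>k=i..j. \<xi> k n \<omega>)\<^sup>2 \<le> \<beta> n * real (j - i + 1)"
      using elim(1)
    proof eventually_elim
      case (elim n)
      let ?h = "\<lambda>(i, j). (\<Sum>k=i..j. \<xi> k n \<omega>)\<^sup>2 / real (j - i + 1)"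
      let ?S = "{(i, j). 1 \<le> i \<and> i \<le> j \<and> j \<le> n}"
      have "finite ?S" by (rule finite_subset[of _ "{..n} \<times> {..n}"]) auto
      show ?case
      proof (intro allI impI)
        fix i j assume "1 \<le> i" "i \<le> j" "j \<le> n"
        then have "?h (i, j) \<le> Max (?h ` ?S)"
          using \<open>finite ?S\<close> by (intro Max_ge finite_imageI imageI) auto
        also have "\<dots> \<le> \<beta> n" by (rule elim)
        finally have "(\<Sum>k=i..j. \<xi> k n \<omega>)\<^sup>2 / real (j - i + 1) \<le> \<beta> n" unfolding prod.case .
        then show "(\<Sum>k=i..j. \<xi> k n \<omega>)\<^sup>2 \<le> \<beta> n * real (j - i + 1)"
          by (subst (asm) pos_divide_le_eq) auto
      qed
    qed
    \<comment> \<open>A preimage of the estimator is chosen for every \<open>n\<close> at the fixed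
      outcome; at \<open>n = 0\<close> it is arbitrary, which the limit does not see.\<close>
    have "\<exists>u. n \<ge> 1 \<longrightarrow> fhat n \<omega> = step_embed n u \<and>
        u \<in> argmin_H_fin n (\<gamma>n n \<omega>) (\<lambda>i. observation f \<xi> i n \<omega>)" for n
      using assms(10)[OF _ elim(3), of n] by blast
    then obtain u where u: "\<And>n. n \<ge> 1 \<Longrightarrow> fhat n \<omega> = step_embed n (u n)"
      "\<And>n. n \<ge> 1 \<Longrightarrow> u n \<in> argmin_H_fin n (\<gamma>n n \<omega>) (\<lambda>i. observation f \<xi> i n \<omega>)"
      by metis
    have "(\<lambda>n. L2_norm (\<lambda>x. step_embed n (u n) x - f_\<gamma> x)) \<longlonglongrightarrow> 0"
    proof (rule penalized_estimates_converge[OF \<open>f \<in> L2\<close> \<open>\<gamma> > 0\<close> \<open>unique_minimizer \<gamma> f f_\<gamma>\<close> elim(2) \<beta> blk])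
      fix n :: nat and v assume n: "n \<ge> 1" and v: "v \<in> {1..n} \<rightarrow>\<^sub>E (UNIV :: real set)"
      have "\<not> H_fin n (\<gamma>n n \<omega>) v (\<lambda>i. observation f \<xi> i n \<omega>) < H_fin n (\<gamma>n n \<omega>) (u n) (\<lambda>i. observation f \<xi> i n \<omega>)"
        using u(2)[OF n] v unfolding argmin_H_fin_def is_arg_min_def by blast
      then show "\<gamma>n n \<omega> * real (change_count n (u n)) + (L2_norm (\<lambda>x. f x - step_embed n (u n) x))\<^sup>2
          - 2 / real n * (\<Sum>i=1..n. u n i * \<xi> i n \<omega>)
        \<le> \<gamma>n n \<omega> * real (change_count n v) + (L2_norm (\<lambda>x. f x - step_embed n v x))\<^sup>2
          - 2 / real n * (\<Sum>i=1..n. v i * \<xi> i n \<omega>)"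
        unfolding H_fin_eq[OF n \<open>f \<in> L2\<close>] by linarith
    qed
    moreover have "\<forall>\<^sub>F n in sequentially. L2_norm (\<lambda>x. step_embed n (u n) x - f_\<gamma> x) = L2_norm (\<lambda>x. fhat n \<omega> x - f_\<gamma> x)"
      using eventually_ge_at_top[of 1] by eventually_elim (simp add: u(1))
    ultimately show ?case by (rule Lim_transform_eventually)
  qed
qed

end
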